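(* Let $N\ge 1$ and $d\ge 1$ be integers. Let $V_d^{\mathrm{diff}}$ be the complex vector space of differentially homogeneous polynomials of degree $d$ in the variables $X=(X_0,\dots,X_N)$. Then $$\dim_{\mathbb{C}} V_d^{\mathrm{diff}}=(N+1)^d .$$ Furthermore, the explicit family $(W_{\mathcal P})_{\mathcal P}$ (defined in the context, and indexed by all data $\mathcal P$ described there) is a basis of $V_d^{\mathrm{diff}}$, and accordingly $$V_d^{\mathrm{diff}}=(V_d^{\mathrm{diff}})^{(d-1)},$$ i.e. every differentially homogeneous polynomial of degree $d$ involves only the variables $X_i^{(j)}$ with $0\le j\le d-1$.
   Context: Differential polynomials: $V=\mathbb{C}[X_i^{(k)} : 0\le i\le N,\ k\in\mathbb{N}]$ is the polynomial ring in the formal variables $X_i^{(k)}$; write $X^{(k)}=(X_0^{(k)},\dots,X_N^{(k)})$ and $X_i=X_i^{(0)}$. For $Q\in\mathbb{C}[T]$ with usual derivatives $Q^{(j)}$, put $(QX)^{(k)}=\sum_{i=0}^{k}\binom{k}{i}Q^{(k-i)}X^{(i)}$, and for $P\in V$ put $Q\cdot P=P\big((QX)^{(0)},(QX)^{(1)},\dots\big)\in V[T]$. $P\in V$ is differentially homogeneous of degree $d$ if $Q\cdot P=Q^dP$ for all $Q\in\mathbb{C}[T]$. $V_d^{\mathrm{diff}}$ is the vector space of such $P$, and $(V_d^{\mathrm{diff}})^{(k)}$ is the subspace of those lying in $\mathbb{C}[X^{(0)},\dots,X^{(k)}]$. Wronskians: for $n_1,\dots,n_d\in\{0,\dots,N\}$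 and $R_1,\dots,R_d\in\mathbb{C}[t]$, $\mathrm{Wronsk}(R_1X_{n_1},\dots,R_dX_{n_d})\in V$ is the value at $t=0$ of the determinant of the $d\times d$ matrix whose entry in row $r$ ($0\le r\le d-1$) and column $k$ ($1\le k\le d$) is $\sum_{j=0}^{r}\binom{r}{j}R_k^{(r-j)}(t)\,X_{n_k}^{(j)}$. Data $\mathcal P$: a datum $\mathcal P$ consists of (a) a tuple $\boldsymbol m=(m_0,\dots,m_N)\in\mathbb{N}^{N+1}$ with $m_0+\dots+m_N=d$; let $i_1<\dots<i_r$ be the indices $i$ with $m_i\ne 0$; and (b) for every $1\le \ell\le r$, integers $0\le \alpha_{i_\ell,1}<\dots<\alpha_{i_\ell,m_{i_\ell}}<m_{i_1}+\dots+m_{i_\ell}$. Set $$W_{\mathcal P}=\mathrm{Wronsk}\big(t^{\alpha_{i_1,1}}X_{i_1},\dots,t^{\alpha_{i_1,m_{i_1}}}X_{i_1},\dots,t^{\alpha_{i_r,1}}X_{i_r},\dots,t^{\alpha_{i_r,m_{i_r}}}X_{i_r}\big).$$ *)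

theory Defs
  imports
    "HOL-Library.Poly_Mapping"
    "HOL-Computational_Algebra.Polynomial"
    "Jordan_Normal_Form.Determinant"
begin

text \<open>
  Complex polynomials in formal variables \<open>X\<^sub>i\<^sup>(\<^sup>k\<^sup>)\<close>, the variable being encoded by the pair \<open>(i, k)\<close>.
  The type has variables for all natural numbers \<open>i\<close>; the ring of differential polynomials
  in \<open>X\<^sub>0, \<dots>, X\<^sub>N\<close> is the subset \<open>diff_polys N\<close> below.
\<close>

type_synonym dpoly = "((nat \<times> nat) \<Rightarrow>\<^sub>0 nat) \<Rightarrow>\<^sub>0 complex"

definition const :: "complex \<Rightarrow> dpoly" where
  "const c = Poly_Mapping.single 0 c"

definition X :: "nat \<Rightarrow> nat \<Rightarrow> dpoly" where
  "X i k = Poly_Mapping.single (Poly_Mapping.single (i, k) 1) 1"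

definition indets :: "dpoly \<Rightarrow> (nat \<times> nat) set" where
  "indets P = (\<Union>m\<in>Poly_Mapping.keys P. Poly_Mapping.keys m)"

definition diff_polys :: "nat \<Rightarrow> dpoly set" where
  "diff_polys N = {P. indets P \<subseteq> {..N} \<times> UNIV}"

definition scale :: "complex \<Rightarrow> dpoly \<Rightarrow> dpoly" where
  "scale c P = const c * P"

lemma const_add: "const (a + b) = const a + const b"
  by (simp add: const_def single_add)

lemma const_mult: "const (a * b) = const a * const b"
  by (simp add: const_def mult_single)

lemma const_1: "const 1 = 1"
  by (simp add: const_def)

interpretation dp: vector_space scale
  by unfold_locales
    (simp_all add: scale_def const_add const_mult const_1 algebra_simps)

text \<open>The inclusion of \<open>\<complex>[T]\<close> into the polynomials in \<open>T\<close> over the differential polynomials.\<close>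

definition lift_poly :: "complex poly \<Rightarrow> dpoly poly" where
  "lift_poly Q = map_poly const Q"

text \<open>The component of index \<open>i\<close> of \<open>(QX)\<^sup>(\<^sup>k\<^sup>)\<close>, as a polynomial in \<open>T\<close>.\<close>

definition deriv_prod :: "complex poly \<Rightarrow> nat \<Rightarrow> nat \<Rightarrow> dpoly poly" where
  "deriv_prod Q i k =
     (\<Sum>j\<le>k. of_nat (k choose j) * lift_poly ((pderiv ^^ (k - j)) Q) * [:X i j:])"

text \<open>Evaluation of \<open>P\<close> with each variable \<open>v\<close> replaced by \<open>f v\<close>.\<close>

definition subst :: "(nat \<times> nat \<Rightarrow> dpoly poly) \<Rightarrow> dpoly \<Rightarrow> dpoly poly" where
  "subst f P = (\<Sum>m\<in>Poly_Mapping.keys P.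
     [:const (Poly_Mapping.lookup P m):] *
     (\<Prod>v\<in>Poly_Mapping.keys m. f v ^ Poly_Mapping.lookup m v))"

definition act :: "complex poly \<Rightarrow> dpoly \<Rightarrow> dpoly poly" where
  "act Q P = subst (\<lambda>(i, k). deriv_prod Q i k) P"

definition diff_homogeneous :: "nat \<Rightarrow> dpoly \<Rightarrow> bool" where
  "diff_homogeneous d P \<longleftrightarrow> (\<forall>Q. act Q P = lift_poly Q ^ d * [:P:])"

definition Vdiff :: "nat \<Rightarrow> nat \<Rightarrow> dpoly set" where
  "Vdiff N d = {P \<in> diff_polys N. diff_homogeneous d P}"

definition Vdiff_order :: "nat \<Rightarrow> nat \<Rightarrow> nat \<Rightarrow> dpoly set" where
  "Vdiff_order N d k = {P \<in> Vdiff N d. indets P \<subseteq> {..N} \<times> {..k}}"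

text \<open>
  The list holds the pairs \<open>(R\<^sub>k, n\<^sub>k)\<close>. The entry in row \<open>r\<close> and column \<open>k\<close> is the formal
  \<open>r\<close>-th derivative of \<open>R\<^sub>k X\<^bsub>n\<^sub>k\<^esub>\<close>; the determinant, a polynomial in \<open>t\<close>, is evaluated at 0.
\<close>

definition wronsk :: "(complex poly \<times> nat) list \<Rightarrow> dpoly" where
  "wronsk Rs =
     poly (det (mat (length Rs) (length Rs)
       (\<lambda>(r, k). deriv_prod (fst (Rs ! k)) (snd (Rs ! k)) r))) 0"

text \<open>
  The tuple \<open>\<alpha> ! i\<close> is recorded for all \<open>i \<le> N\<close>, not only for those with \<open>m ! i \<noteq> 0\<close>: it is
  empty when \<open>m ! i = 0\<close>. Likewise the indices \<open>j\<close> with \<open>m ! j = 0\<close> contribute nothing to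
  the bound \<open>\<Sum>j\<le>i. m ! j\<close>, which is thus the sum over the nonzero \<open>m ! j\<close> with \<open>j \<le> i\<close>.
\<close>

definition wronsk_data :: "nat \<Rightarrow> nat \<Rightarrow> (nat list \<times> nat list list) set" where
  "wronsk_data N d = {(m, \<alpha>).
     length m = N + 1 \<and> (\<Sum>i\<le>N. m ! i) = d \<and> length \<alpha> = N + 1 \<and>
     (\<forall>i\<le>N. length (\<alpha> ! i) = m ! i \<and> sorted_wrt (<) (\<alpha> ! i) \<and>
       (\<forall>a\<in>set (\<alpha> ! i). a < (\<Sum>j\<le>i. m ! j)))}"

definition W :: "nat list \<times> nat list list \<Rightarrow> dpoly" where
  "W = (\<lambda>(m, \<alpha>). wronsk
     (concat (map (\<lambda>i. map (\<lambda>a. (monom 1 a, i)) (\<alpha> ! i)) [0..<length m])))"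

end

theory Submission
  imports Defs
begin

text \<open>
  In the divided variables \<open>x\<^sub>i\<^sub>,\<^sub>s = X\<^sub>i\<^sup>(\<^sup>s\<^sup>) / s!\<close> the Wronskian with exponents \<open>a\<^sub>c\<close> and
  indices \<open>i\<^sub>c\<close> is, up to a scalar, the determinant of the matrix with entry of index \<open>i\<^sub>c\<close>, \<open>r - a\<^sub>c\<close>
  in row \<open>r\<close> and column \<open>c\<close>. Replacing \<open>X\<close> by \<open>QX\<close> multiplies this matrix by a triangular Toeplitz
  matrix with diagonal \<open>Q\<close>, so the Wronskian is differentially homogeneous.

  Let \<open>y\<^sub>c\<close> raise the \<open>c\<close>-th argument of a function on \<open>\<nat>\<^sup>d\<close> by one. As a function of the exponents,
  the determinant is killed by all elementary symmetric polynomials in the \<open>y\<^sub>c\<close>; hence \<open>y\<^sub>c\<^sup>n\<close> acts on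
  it as \<open>\<plusminus>\<close> the \<open>n\<close>-th elementary symmetric polynomial in the other \<open>y\<close>'s, which moves weight
  towards the larger indices until the exponents obey the bounds of a datum. The coefficients of a
  differentially homogeneous polynomial, as functions of the orders of derivation, are killed by the
  same operators (take \<open>Q = T\<close>). The functions killed by them are the dual of the coinvariant algebra
  of the symmetric group, and are the combinations of the shifts of \<open>b \<mapsto> sgn b\<close> (which is 0 unless
  \<open>b\<close> is a permutation of \<open>0, \<dots>, d - 1\<close>); so every differentially homogeneous polynomial is a
  combination of Wronskians.

  For independence, write \<open>\<beta>\<^sub>c = d i\<^sub>c + a\<^sub>c\<close>, increasing in \<open>c\<close>. Giving \<open>x\<^sub>i\<^sub>,\<^sub>s\<close> the weight
  \<open>(s - d i)\<^sup>2\<close>, the term of the permutation \<open>p\<close> has weight \<open>\<Sum>\<^sub>c (p c - \<beta>\<^sub>c)\<^sup>2\<close>, which by the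
  rearrangement inequality is smallest only for \<open>p = id\<close>; and the diagonal monomial determines the
  datum.
\<close>

section \<open>Functions killed by the elementary symmetric shift operators\<close>


definition raise :: "nat set \<Rightarrow> (nat \<Rightarrow> nat) \<Rightarrow> nat \<Rightarrow> nat" where
  "raise S b = (\<lambda>c. b c + of_bool (c \<in> S))"

text \<open>The condition that e_j(y) kills \<Psi> for every j \<ge> 1. Values lie in an arbitrary
  abelian group, because the notion is applied both to complex coefficients and to
  determinants.\<close>

definition coinvariant :: "nat \<Rightarrow> ((nat \<Rightarrow> nat) \<Rightarrow> 'v::ab_group_add) \<Rightarrow> bool" where
  "coinvariant d \<Psi> \<longleftrightarrow>
     (\<forall>b. \<forall>j\<ge>1. (\<Sum>S | S \<subseteq> {..<d} \<and> card S = j. \<Psi> (raise S b)) = 0)"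

text \<open>Closure under differences makes \<open>U\<close> an additive subgroup. The reductions
  below take for \<open>U\<close> either \<open>{0}\<close> or a span.\<close>

lemma sum_mem_if_diff_closed:
  fixes U :: "'v::ab_group_add set"
  assumes "0 \<in> U" and "\<And>x y. x \<in> U \<Longrightarrow> y \<in> U \<Longrightarrow> x - y \<in> U"
    and "\<And>x. x \<in> A \<Longrightarrow> f x \<in> U"
  shows "sum f A \<in> U"
proof -
  have plus: "x + y \<in> U" if "x \<in> U" "y \<in> U" for x y
    using assms(2)[OF that(1) assms(2)[OF assms(1) that(2)]] by simp
  show ?thesis
    using assms(3) by (induction A rule: infinite_finite_induct) (auto simp: assms(1) plus)
qed

text \<open>The recursion e_{n+1}(y) = e_{n+1}(y') + y_c e_n(y'), where y' omits y_c: split the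
  subsets according to whether they contain \<open>c\<close>.\<close>

lemma sum_subsets_split:
  fixes \<Psi> :: "(nat \<Rightarrow> nat) \<Rightarrow> 'v::ab_group_add"
  assumes "c < d"
  shows "(\<Sum>S | S \<subseteq> {..<d} \<and> card S = Suc n. \<Psi> (raise S b)) =
    (\<Sum>S | S \<subseteq> {..<d} - {c} \<and> card S = Suc n. \<Psi> (raise S b)) +
    (\<Sum>S | S \<subseteq> {..<d} - {c} \<and> card S = n. \<Psi> (raise S (b(c := Suc (b c)))))"
proof -
  let ?A = "{S. S \<subseteq> {..<d} - {c} \<and> card S = Suc n}"
  let ?B = "{S. S \<subseteq> {..<d} - {c} \<and> card S = n}"
  have fin: "finite S" if "S \<subseteq> {..<d} - {c}" for S
    using that finite_subset[of S "{..<d}"] by auto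
  have finA: "finite ?A" "finite ?B"
    by (rule finite_subset[of _ "Pow {..<d}"]; auto)+
  have eq: "{S. S \<subseteq> {..<d} \<and> card S = Suc n} = ?A \<union> insert c ` ?B"
  proof (intro Set.set_eqI iffI)
    fix S assume S: "S \<in> {S. S \<subseteq> {..<d} \<and> card S = Suc n}"
    then have f: "finite S" using finite_subset[of S "{..<d}"] by auto
    show "S \<in> ?A \<union> insert c ` ?B"
    proof (cases "c \<in> S")
      case True
      then have "S = insert c (S - {c})" "S - {c} \<in> ?B" using S f by auto
      then show ?thesis by blast
    qed (use S in auto)
  next
    fix S assume S: "S \<in> ?A \<union> insert c ` ?B"
    then show "S \<in> {S. S \<subseteq> {..<d} \<and> card S = Suc n}"
    proof
      assume "S \<in> insert c ` ?B"
      then obtain S' where S': "S = insert c S'" "S' \<in> ?B" by blast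
      have "c \<notin> S'" using S'(2) by auto
      then show ?thesis using S' fin[of S'] assms by auto
    qed auto
  qed
  have inj: "inj_on (insert c) ?B"
    by (intro inj_onI) (metis (mono_tags, lifting) CollectD Diff_insert_absorb insert_Diff_single subset_Diff_insert Diff_iff)
  have "(\<Sum>S | S \<subseteq> {..<d} \<and> card S = Suc n. \<Psi> (raise S b)) =
      (\<Sum>S\<in>?A. \<Psi> (raise S b)) + (\<Sum>S\<in>insert c ` ?B. \<Psi> (raise S b))"
    unfolding eq by (rule sum.union_disjoint) (use finA in auto)
  also have "(\<Sum>S\<in>insert c ` ?B. \<Psi> (raise S b)) = (\<Sum>S\<in>?B. \<Psi> (raise (insert c S) b))"
    by (simp add: sum.reindex[OF inj])
  also have "\<dots> = (\<Sum>S\<in>?B. \<Psi> (raise S (b(c := Suc (b c)))))"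
    by (rule sum.cong[OF refl], rule arg_cong[of _ _ \<Psi>]) (auto simp: raise_def fun_eq_iff)
  finally show ?thesis .
qed

text \<open>By the recursion, e_{n+1}(y') = - y_c e_n(y') on \<Psi>, hence e_n(y') = (-1)^n y_c^n.
  Membership in a subgroup absorbs the sign.\<close>

lemma coinvariant_raise_mem_iff:
  fixes \<Psi> :: "(nat \<Rightarrow> nat) \<Rightarrow> 'v::ab_group_add"
  assumes \<Psi>: "coinvariant d \<Psi>" and c: "c < d"
    and U0: "0 \<in> U" and Um: "\<And>x y. x \<in> U \<Longrightarrow> y \<in> U \<Longrightarrow> x - y \<in> U"
  shows "(\<Sum>S | S \<subseteq> {..<d} - {c} \<and> card S = n. \<Psi> (raise S b)) \<in> U \<longleftrightarrow>
    \<Psi> (b(c := b c + n)) \<in> U"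
proof (induction n arbitrary: b)
  case 0
  have "{S. S \<subseteq> {..<d} - {c} \<and> card S = 0} = {{}}"
    using finite_subset[of _ "{..<d} - {c}"] by auto
  moreover have "raise {} b = b" by (simp add: raise_def)
  ultimately show ?case by simp
next
  case (Suc n)
  let ?x = "\<Sum>S | S \<subseteq> {..<d} - {c} \<and> card S = Suc n. \<Psi> (raise S b)"
  let ?y = "\<Sum>S | S \<subseteq> {..<d} - {c} \<and> card S = n. \<Psi> (raise S (b(c := Suc (b c))))"
  have "?x + ?y = 0"
    using \<Psi> sum_subsets_split[OF c, where n = n and \<Psi> = \<Psi> and b = b] unfolding coinvariant_def by auto
  then have "?x = - ?y" by (rule eq_neg_iff_add_eq_0[THEN iffD2])
  moreover have "- z \<in> U \<longleftrightarrow> z \<in> U" for z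
    using Um[OF U0, of z] Um[OF U0, of "- z"] by auto
  moreover have "b(c := b c + Suc n) = b(c := Suc (b c), c := (b(c := Suc (b c))) c + n)"
    by (simp add: fun_eq_iff)
  ultimately show ?case using Suc.IH[of "b(c := Suc (b c))"] by (simp only:)
qed

text \<open>A reduction step replaces \<open>b\<close> by vectors with the same sum and larger
  \<open>\<Sum>\<^sub>c b\<^sub>c (d + 1)\<^bsup>i\<^sub>c\<^esup>\<close>: among the \<open>n\<close> positions that are raised, one has index above \<open>i\<^sub>c\<close>.\<close>

lemma coinvariant_reduce:
  fixes \<Psi> :: "(nat \<Rightarrow> nat) \<Rightarrow> 'v::ab_group_add" and i :: "nat \<Rightarrow> nat"
  assumes \<Psi>: "coinvariant d \<Psi>"
    and U0: "0 \<in> U" and Um: "\<And>x y. x \<in> U \<Longrightarrow> y \<in> U \<Longrightarrow> x - y \<in> U"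
    and good: "\<And>b. (\<And>c. c < d \<Longrightarrow> b c < card {c'. c' < d \<and> i c' \<le> i c}) \<Longrightarrow> \<Psi> b \<in> U"
  shows "\<Psi> b \<in> U"
proof -
  \<comment> \<open>With base d + 1, the at most d units removed at position \<open>c\<close>
    together weigh less than one unit at a position of larger index.\<close>
  define K where "K = Suc d"
  define I where "I = (\<Sum>c<d. i c)"
  define wt where "wt b = (\<Sum>c<d. b c * K ^ i c)" for b :: "nat \<Rightarrow> nat"
  have bound: "wt b \<le> (\<Sum>c<d. b c) * K ^ I" for b
    unfolding wt_def sum_distrib_right I_def K_def
    by (intro sum_mono mult_le_mono2 power_increasing member_le_sum) auto
  \<comment> \<open>For a fixed total \<open>s\<close> the weight is bounded by
    \<open>s * K ^ I\<close>, since every index is at most \<open>I\<close>; the distance to this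
    bound is the induction measure.\<close>
  have "\<Psi> b \<in> U" if "(\<Sum>c<d. b c) = s" for s b
    using that
  proof (induction "s * K ^ I - wt b" arbitrary: b rule: less_induct)
    case less
    show ?case
    proof (cases "\<exists>c<d. \<not> b c < card {c'. c' < d \<and> i c' \<le> i c}")
      case False
      then show ?thesis using good by blast
    next
      case True
      define n where "n c = card {c'. c' < d \<and> i c' \<le> i c}" for c
      from True obtain c where c: "c < d" "n c \<le> b c" unfolding n_def by auto
      \<comment> \<open>\<open>b\<close> is \<open>b0\<close> raised \<open>n c\<close> times at
        \<open>c\<close>, so the value at \<open>b\<close> is exchanged for values at vectors
        obtained from \<open>b0\<close> by raising \<open>n c\<close> other positions.\<close>
      define b0 where "b0 = b(c := b c - n c)"
      have b: "b = b0(c := b0 c + n c)" using c by (auto simp: b0_def)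
      have step: "\<Psi> (raise S b0) \<in> U" if S: "S \<subseteq> {..<d} - {c}" "card S = n c" for S
      proof -
        have finS: "finite S" using S(1) finite_subset by blast
        \<comment> \<open>Besides \<open>c\<close> itself only \<open>n c - 1\<close> positions have
          index at most \<open>i c\<close>, too few for \<open>S\<close>.\<close>
        have "\<not> S \<subseteq> {c'. c' < d \<and> i c' \<le> i c} - {c}"
        proof
          assume "S \<subseteq> {c'. c' < d \<and> i c' \<le> i c} - {c}"
          then have "card S \<le> card ({c'. c' < d \<and> i c' \<le> i c} - {c})"
            by (intro card_mono) auto
          also have "\<dots> < n c"
            unfolding n_def using c by (intro psubset_card_mono) auto
          finally show False using S by simp
        qed
        then obtain e where e: "e \<in> S" "i c < i e"
          using S(1) by (force simp: not_le subset_iff)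
        have dec: "(\<Sum>c<d. f c * b c) = (\<Sum>c<d. f c * b0 c) + n c * f c" for f :: "nat \<Rightarrow> nat"
        proof -
          have "(\<Sum>x<d. f x * b x) = (\<Sum>x<d. f x * b0 x + (if x = c then n c * f c else 0))"
            using c by (intro sum.cong) (auto simp: b0_def algebra_simps diff_mult_distrib2)
          then show ?thesis using c by (simp add: sum.distrib)
        qed
        have inc: "(\<Sum>c<d. f c * raise S b0 c) = (\<Sum>c<d. f c * b0 c) + (\<Sum>c\<in>S. f c)"
          for f :: "nat \<Rightarrow> nat"
        proof -
          have "(\<Sum>c<d. f c * of_bool (c \<in> S)) = (\<Sum>c\<in>{..<d} \<inter> S. f c)"
            by (simp add: sum.If_cases of_bool_def if_distrib cong: if_cong)
          also have "{..<d} \<inter> S = S" using S by auto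
          finally show ?thesis by (simp add: raise_def algebra_simps sum.distrib)
        qed
        have tot: "(\<Sum>c<d. raise S b0 c) = s"
          using inc[of "\<lambda>_. 1"] dec[of "\<lambda>_. 1"] less.prems S(2) by simp
        have "n c * K ^ i c < K ^ Suc (i c)"
        proof -
          have "n c \<le> card {..<d}" unfolding n_def by (intro card_mono) auto
          then show ?thesis by (simp add: K_def le_imp_less_Suc del: mult_Suc)
        qed
        also have "\<dots> \<le> K ^ i e" using e by (intro power_increasing) (auto simp: K_def)
        also have "\<dots> \<le> (\<Sum>c\<in>S. K ^ i c)" using e finS by (intro member_le_sum) auto
        finally have "wt b < wt (raise S b0)"
          using inc[of "\<lambda>c. K ^ i c"] dec[of "\<lambda>c. K ^ i c"] by (simp add: wt_def mult.commute)
        moreover have "wt (raise S b0) \<le> s * K ^ I" using bound[of "raise S b0"] tot by simp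
        ultimately show ?thesis by (intro less.hyps) (use tot in auto)
      qed
      have "(\<Sum>S | S \<subseteq> {..<d} - {c} \<and> card S = n c. \<Psi> (raise S b0)) \<in> U"
        by (rule sum_mem_if_diff_closed[OF U0 Um]) (use step in auto)
      then show ?thesis
        using coinvariant_raise_mem_iff[OF \<Psi> c(1) U0 Um, where n = "n c" and b = b0] b by simp
    qed
  qed
  then show ?thesis by simp
qed

section \<open>The sign function and its shifts\<close>

text \<open>At most one summand is nonzero. The form as a sum over permutations is the one in which
  it appears in a Leibniz expansion.\<close>

definition perm_sign :: "nat \<Rightarrow> (nat \<Rightarrow> nat) \<Rightarrow> complex" where
  "perm_sign d b = (\<Sum>p | p permutes {..<d}. of_int (sign p) * of_bool (\<forall>c<d. b c = p c))"

lemma perm_sign_cong: "(\<And>c. c < d \<Longrightarrow> b c = b' c) \<Longrightarrow> perm_sign d b = perm_sign d b'"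
  by (simp add: perm_sign_def)

lemma perm_sign_nonzeroE:
  assumes "perm_sign d b \<noteq> 0"
  obtains p where "p permutes {..<d}" "\<And>c. c < d \<Longrightarrow> b c = p c"
proof (rule ccontr)
  assume "\<not> thesis"
  with that have "\<not> (p permutes {..<d} \<and> (\<forall>c<d. b c = p c))" for p by blast
  then have "perm_sign d b = 0" unfolding perm_sign_def by (intro sum.neutral) auto
  with assms show False by simp
qed

lemma perm_sign_comp:
  assumes q: "q permutes {..<d}"
  shows "perm_sign d (\<lambda>c. b (q c)) = of_int (sign q) * perm_sign d b"
proof -
  have "perm_sign d (\<lambda>c. b (q c)) =
      (\<Sum>p | p permutes {..<d}. of_int (sign (p \<circ> q)) * of_bool (\<forall>c<d. b (q c) = (p \<circ> q) c))"
    unfolding perm_sign_def by (rule sum.reindex_bij_betw[symmetric])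
      (intro bij_betwI[where g = "\<lambda>p. p \<circ> inv_into UNIV q"];
       auto simp: permutes_compose permutes_inv q o_assoc[symmetric] permutes_inv_o[OF q])
  also have "\<dots> = (\<Sum>p | p permutes {..<d}. of_int (sign q) * (of_int (sign p) * of_bool (\<forall>c<d. b c = p c)))"
  proof (rule sum.cong[OF refl])
    fix p assume "p \<in> {p. p permutes {..<d}}"
    then have p: "p permutes {..<d}" by simp
    have "(\<forall>c<d. b (q c) = (p \<circ> q) c) \<longleftrightarrow> (\<forall>c\<in>q ` {..<d}. b c = p c)" by auto
    also have "\<dots> \<longleftrightarrow> (\<forall>c<d. b c = p c)" by (auto simp: permutes_image[OF q])
    finally have 1: "(\<forall>c<d. b (q c) = (p \<circ> q) c) \<longleftrightarrow> (\<forall>c<d. b c = p c)" .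
    have 2: "sign (p \<circ> q) = sign p * sign q"
      by (rule sign_compose) (use p q permutation_permutes in blast)+
    show "of_int (sign (p \<circ> q)) * of_bool (\<forall>c<d. b (q c) = (p \<circ> q) c) =
      (of_int (sign q) * (of_int (sign p) * of_bool (\<forall>c<d. b c = p c)) :: complex)"
      unfolding 1 2 by simp
  qed
  finally show ?thesis by (simp add: perm_sign_def sum_distrib_left)
qed

text \<open>If \<open>b\<close> is injective and some \<open>raise S b\<close> is a permutation,
  then \<open>b\<close> has values below \<open>d\<close> and is a permutation too, but the two have
  different sums; so every term vanishes. If \<open>b\<close> has two equal entries, transposing
  their positions permutes the sets \<open>S\<close> and flips the sign of each term.\<close>

lemma coinvariant_perm_sign: "coinvariant d (perm_sign d)"
  unfolding coinvariant_def
proof (intro allI impI)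
  fix b :: "nat \<Rightarrow> nat" and j :: nat
  assume j: "1 \<le> j"
  let ?A = "{S. S \<subseteq> {..<d} \<and> card S = j}"
  show "(\<Sum>S\<in>?A. perm_sign d (raise S b)) = 0"
  proof (cases "inj_on b {..<d}")
    case True
    show ?thesis
    proof (rule sum.neutral, intro ballI, rule ccontr)
      fix S assume S: "S \<in> ?A" and "perm_sign d (raise S b) \<noteq> 0"
      then obtain p where p: "p permutes {..<d}" "\<And>c. c < d \<Longrightarrow> raise S b c = p c"
        by (auto elim: perm_sign_nonzeroE)
      have "b c < d" if "c < d" for c
        using p(2)[OF that] permutes_in_image[OF p(1), of c] that by (auto simp: raise_def)
      then have "b ` {..<d} = {..<d}" using True by (intro endo_inj_surj) auto
      then have "sum b {..<d} = sum id {..<d}"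
        using sum.reindex[OF True, of id] by simp
      moreover have "sum p {..<d} = sum id {..<d}"
        using sum.reindex[OF permutes_inj_on[OF p(1)], of id "{..<d}"] permutes_image[OF p(1)] by simp
      moreover have "sum p {..<d} = sum (raise S b) {..<d}" by (intro sum.cong) (use p in auto)
      moreover have "sum (raise S b) {..<d} = sum b {..<d} + card ({..<d} \<inter> S)"
        by (simp add: raise_def sum.distrib sum.If_cases of_bool_def)
      moreover have "{..<d} \<inter> S = S" using S by auto
      ultimately show False using S j by simp
    qed
  next
    case False
    then obtain u v where uv: "u < d" "v < d" "u \<noteq> v" "b u = b v"
      by (auto simp: inj_on_def)
    define \<tau> where "\<tau> = transpose u v"
    have \<tau>: "\<tau> permutes {..<d}" unfolding \<tau>_def using uv by (intro permutes_swap_id) auto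
    have \<tau>\<tau>: "\<tau> (\<tau> c) = c" for c by (simp add: \<tau>_def)
    have b\<tau>: "b (\<tau> c) = b c" for c using uv by (simp add: \<tau>_def transpose_def)
    have mem: "\<tau> ` S \<in> ?A" if "S \<in> ?A" for S
    proof -
      have "\<tau> ` S \<subseteq> \<tau> ` {..<d}" using that by (intro image_mono) auto
      moreover have "card (\<tau> ` S) = card S" by (rule card_image, rule permutes_inj_on[OF \<tau>])
      ultimately show ?thesis using that permutes_image[OF \<tau>] by simp
    qed
    have "(\<Sum>S\<in>?A. perm_sign d (raise S b)) = (\<Sum>S\<in>?A. perm_sign d (raise (\<tau> ` S) b))"
      by (rule sum.reindex_bij_witness[where i = "(`) \<tau>" and j = "(`) \<tau>"])
        (use mem in \<open>auto simp: image_image \<tau>\<tau>\<close>)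
    also have "\<dots> = (\<Sum>S\<in>?A. - perm_sign d (raise S b))"
    proof (rule sum.cong[OF refl])
      fix S
      have "c \<in> \<tau> ` S \<longleftrightarrow> \<tau> c \<in> S" for c using \<tau>\<tau> by (metis imageE image_eqI)
      then have "raise (\<tau> ` S) b = (\<lambda>c. raise S b (\<tau> c))" by (simp add: raise_def b\<tau>)
      then have "perm_sign d (raise (\<tau> ` S) b) = of_int (sign \<tau>) * perm_sign d (raise S b)"
        using perm_sign_comp[OF \<tau>] by simp
      then show "perm_sign d (raise (\<tau> ` S) b) = - perm_sign d (raise S b)"
        using uv by (simp add: \<tau>_def sign_swap_id)
    qed
    also have "\<dots> = - (\<Sum>S\<in>?A. perm_sign d (raise S b))" by (rule sum_negf)
    finally show ?thesis by simp
  qed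
qed

lemma coinvariant_add_left:
  assumes "coinvariant d \<Psi>"
  shows "coinvariant d (\<lambda>r. \<Psi> (\<lambda>c. a c + r c))"
proof -
  have "(\<lambda>c. a c + raise S b c) = raise S (\<lambda>c. a c + b c)" for S and b :: "nat \<Rightarrow> nat"
    by (simp add: raise_def add.assoc)
  then show ?thesis using assms by (simp add: coinvariant_def)
qed

lemma coinvariant_diff:
  "coinvariant d \<Psi> \<Longrightarrow> coinvariant d \<Phi> \<Longrightarrow> coinvariant d (\<lambda>r. \<Psi> r - \<Phi> r)"
  by (simp add: coinvariant_def sum_subtractf)

lemma coinvariant_sum_scaled:
  fixes f :: "'a \<Rightarrow> (nat \<Rightarrow> nat) \<Rightarrow> 'v::comm_ring"
  assumes "\<And>x. x \<in> A \<Longrightarrow> coinvariant d (f x)"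
  shows "coinvariant d (\<lambda>r. \<Sum>x\<in>A. f x r * g x)"
  unfolding coinvariant_def
proof (intro allI impI)
  fix b :: "nat \<Rightarrow> nat" and j :: nat
  assume "1 \<le> j"
  have "(\<Sum>S | S \<subseteq> {..<d} \<and> card S = j. \<Sum>x\<in>A. f x (raise S b) * g x) =
      (\<Sum>x\<in>A. (\<Sum>S | S \<subseteq> {..<d} \<and> card S = j. f x (raise S b)) * g x)"
    unfolding sum_distrib_right by (rule sum.swap)
  also have "\<dots> = 0"
    by (intro sum.neutral) (use assms \<open>1 \<le> j\<close> in \<open>auto simp: coinvariant_def\<close>)
  finally show "(\<Sum>S | S \<subseteq> {..<d} \<and> card S = j. \<Sum>x\<in>A. f x (raise S b) * g x) = 0" .
qed

text \<open>The functions \<open>r \<mapsto> perm_sign d (\<lambda>c. c - a c + r c)\<close> with \<open>a c \<le> c\<close> are unitriangular at the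
  points \<open>r\<close> with \<open>r c \<le> c\<close>, with respect to \<open>\<Sum>\<^sub>c c a\<^sub>c\<close>; by \<open>coinvariant_reduce\<close> these points
  determine a coinvariant function.\<close>

lemma perm_sign_triangular:
  fixes a r :: "nat \<Rightarrow> nat"
  assumes a: "\<And>c. c < d \<Longrightarrow> a c \<le> c"
    and nz: "perm_sign d (\<lambda>c. c - a c + r c) \<noteq> 0"
    and le: "(\<Sum>c<d. c * a c) \<le> (\<Sum>c<d. c * r c)"
  shows "\<forall>c<d. r c = a c"
proof -
  obtain p where p: "p permutes {..<d}" "\<And>c. c < d \<Longrightarrow> c - a c + r c = p c"
    using perm_sign_nonzeroE[OF nz] by blast
  have r: "int (p c) = int c - int (a c) + int (r c)" if "c < d" for c
    using p(2)[OF that] a[OF that] by linarith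
  have sq: "(\<Sum>c<d. (int (p c))\<^sup>2) = (\<Sum>c<d. (int c)\<^sup>2)"
    using sum.reindex[OF permutes_inj_on[OF p(1)], of "\<lambda>c. (int c)\<^sup>2" "{..<d}"]
      permutes_image[OF p(1)] by simp
  \<comment> \<open>As \<open>p\<close> and the identity have the same sum of squares, the squared
    distance between them is linear in \<open>p\<close>, namely twice the difference of the two sums
    in \<open>le\<close>. So it is at most 0, which forces \<open>p c = c\<close> and then
    \<open>r c = a c\<close>.\<close>
  have "(\<Sum>c<d. (int (p c) - int c)\<^sup>2) =
      (\<Sum>c<d. (int (p c))\<^sup>2) + (\<Sum>c<d. (int c)\<^sup>2) - (\<Sum>c<d. 2 * int c * int (p c))"
    by (simp add: power2_diff sum.distrib sum_subtractf algebra_simps)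
  also have "\<dots> = (\<Sum>c<d. 2 * (int c)\<^sup>2 - 2 * int c * int (p c))"
    by (simp add: sq sum_subtractf sum_distrib_left[symmetric])
  also have "\<dots> = (\<Sum>c<d. 2 * (int (c * a c) - int (c * r c)))"
    by (intro sum.cong) (auto simp: r algebra_simps power2_eq_square)
  also have "\<dots> = 2 * (int (\<Sum>c<d. c * a c) - int (\<Sum>c<d. c * r c))"
    by (simp add: sum_distrib_left sum_subtractf algebra_simps)
  also have "\<dots> \<le> 0" using le by (simp only: mult_le_0_iff of_nat_le_iff diff_le_0_iff_le) simp
  finally have "(\<Sum>c<d. (int (p c) - int c)\<^sup>2) \<le> 0" .
  then have "(\<Sum>c<d. (int (p c) - int c)\<^sup>2) = 0"
    by (intro order.antisym sum_nonneg) auto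
  then have "\<forall>c<d. int (p c) = int c"
    by (subst (asm) sum_nonneg_eq_0_iff) auto
  then show ?thesis using r by force
qed

lemma coinvariant_spanned:
  fixes \<Psi> :: "(nat \<Rightarrow> nat) \<Rightarrow> complex"
  assumes "coinvariant d \<Psi>"
    and "\<And>r r'. (\<And>c. c < d \<Longrightarrow> r c = r' c) \<Longrightarrow> \<Psi> r = \<Psi> r'"
  shows "\<exists>g. \<forall>r. \<Psi> r =
    (\<Sum>a\<in>PiE {..<d} (\<lambda>c. {..c}). perm_sign d (\<lambda>c. c - a c + r c) * g a)"
proof -
  define A where "A = PiE {..<d} (\<lambda>c::nat. {..c})"
  define \<rho> where "\<rho> r = (\<Sum>c<d. c * r c)" for r :: "nat \<Rightarrow> nat"
  define F where "F a r = perm_sign d (\<lambda>c. c - a c + r c)" for a r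
  have finA: "finite A" unfolding A_def by (intro finite_PiE) auto
  have Aeq: "a = r" if "a \<in> A" "r \<in> A" "\<forall>c<d. r c = a c" for a r
    using that unfolding A_def by (intro PiE_ext[where x = a and y = r]) auto
  have F_tri: "F a r = of_bool (r = a)" if "a \<in> A" "r \<in> A" "\<rho> a \<le> \<rho> r" for a r
  proof (cases "r = a")
    case True
    have "perm_sign d (\<lambda>c. c - a c + a c) = perm_sign d id"
      using that by (intro perm_sign_cong) (auto simp: A_def PiE_iff)
    also have "\<dots> = (\<Sum>p | p permutes {..<d}. if p = id then 1 else 0)"
      unfolding perm_sign_def
    proof (rule sum.cong[OF refl])
      fix p assume "p \<in> {p. p permutes {..<d}}"
      then have "(\<forall>c<d. id c = p c) \<longleftrightarrow> p = id"
        by (auto simp: fun_eq_iff) (metis lessThan_iff permutes_def)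
      then show "of_int (sign p) * of_bool (\<forall>c<d. id c = p c) = (if p = id then 1 else 0 :: complex)"
        by (auto simp: sign_id)
    qed
    also have "\<dots> = 1" by (simp add: finite_permutations permutes_id)
    finally show ?thesis using True by (simp add: F_def)
  next
    case False
    have "F a r = 0"
    proof (rule ccontr)
      assume "F a r \<noteq> 0"
      then have "\<forall>c<d. r c = a c"
        using that unfolding F_def \<rho>_def by (intro perm_sign_triangular) (auto simp: A_def PiE_iff)
      then show False using Aeq that False by blast
    qed
    then show ?thesis using False by simp
  qed
  have F_coinv: "coinvariant d (F a)" for a
    unfolding F_def by (rule coinvariant_add_left[OF coinvariant_perm_sign])
  have F_cong: "F a r = F a r'" if "\<And>c. c < d \<Longrightarrow> r c = r' c" for a r r'
    unfolding F_def by (rule perm_sign_cong) (simp add: that)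
  \<comment> \<open>Elimination from the top: \<open>n\<close> bounds the values of
    \<open>\<rho>\<close> at the points of \<open>A\<close> where \<Psi> may still be
    nonzero.\<close>
  have main: "\<exists>g. \<forall>r. \<Psi> r = (\<Sum>a\<in>A. F a r * g a)"
    if "coinvariant d \<Psi>" "\<And>r r'. (\<And>c. c < d \<Longrightarrow> r c = r' c) \<Longrightarrow> \<Psi> r = \<Psi> r'"
      "\<And>r. r \<in> A \<Longrightarrow> n \<le> \<rho> r \<Longrightarrow> \<Psi> r = 0" for n and \<Psi> :: "(nat \<Rightarrow> nat) \<Rightarrow> complex"
    using that
  proof (induction n arbitrary: \<Psi>)
    case 0
    \<comment> \<open>With the indices \<open>i = id\<close> the reduced vectors are exactly those
      with \<open>b c \<le> c\<close>, that is, the points of \<open>A\<close> up to values outside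
      \<open>{..<d}\<close>.\<close>
    have "\<Psi> r \<in> {0}" for r
    proof (rule coinvariant_reduce[OF 0(1), where i = id])
      fix b assume b: "\<And>c. c < d \<Longrightarrow> b c < card {c'. c' < d \<and> id c' \<le> id c}"
      have "b c \<le> c" if "c < d" for c
      proof -
        have "{c'. c' < d \<and> id c' \<le> id c} = {..c}" using that by auto
        then show ?thesis using b[OF that] by simp
      qed
      then have "restrict b {..<d} \<in> A" by (auto simp: A_def)
      then have "\<Psi> (restrict b {..<d}) = 0" using 0(3) by simp
      moreover have "\<Psi> b = \<Psi> (restrict b {..<d})" by (rule 0(2)) simp
      ultimately show "\<Psi> b \<in> {0}" by simp
    qed auto
    then show ?case by (intro exI[of _ "\<lambda>_. 0"]) auto
  next
    case (Suc n)
    \<comment> \<open>Subtracting the functions \<open>F a\<close> with \<open>\<rho> a = n\<close>,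
      each scaled by the value of \<Psi> at \<open>a\<close>, clears level \<open>n\<close>; by
      \<open>F_tri\<close> it leaves the zeros at higher levels untouched.\<close>
    define h where "h a = (if \<rho> a = n then \<Psi> a else 0)" for a
    define \<Phi> where "\<Phi> r = \<Psi> r - (\<Sum>a\<in>A. F a r * h a)" for r
    have "\<exists>g. \<forall>r. \<Phi> r = (\<Sum>a\<in>A. F a r * g a)"
    proof (rule Suc.IH)
      show "coinvariant d \<Phi>" unfolding \<Phi>_def
        by (intro coinvariant_diff coinvariant_sum_scaled Suc.prems(1) F_coinv)
      show "\<Phi> r = \<Phi> r'" if "\<And>c. c < d \<Longrightarrow> r c = r' c" for r r'
        unfolding \<Phi>_def using Suc.prems(2)[of r r'] F_cong[of r r'] that by simp
      show "\<Phi> r = 0" if r: "r \<in> A" "n \<le> \<rho> r" for r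
      proof -
        have "(\<Sum>a\<in>A. F a r * h a) = (\<Sum>a\<in>A. if a = r then h r else 0)"
        proof (rule sum.cong[OF refl])
          fix a assume "a \<in> A"
          then show "F a r * h a = (if a = r then h r else 0)"
            using F_tri[of a r] r by (cases "\<rho> a = n") (auto simp: h_def)
        qed
        also have "\<dots> = h r" using finA r by simp
        finally show ?thesis using Suc.prems(3)[of r] r by (simp add: \<Phi>_def h_def)
      qed
    qed
    then obtain g where g: "\<And>r. \<Phi> r = (\<Sum>a\<in>A. F a r * g a)" by blast
    have "\<Psi> r = (\<Sum>a\<in>A. F a r * (g a + h a))" for r
      using g[of r] by (simp add: \<Phi>_def algebra_simps sum.distrib)
    then show ?case by (intro exI[of _ "\<lambda>a. g a + h a"]) auto
  qed
  \<comment> \<open>A starting level above all values of \<open>\<rho>\<close> on the finite set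
    \<open>A\<close>, where the vanishing hypothesis is vacuous.\<close>
  have "\<rho> r < Suc (\<Sum>a\<in>A. \<rho> a)" if "r \<in> A" for r
    using member_le_sum[OF that, of \<rho>] finA by simp
  then have "\<exists>g. \<forall>r. \<Psi> r = (\<Sum>a\<in>A. F a r * g a)"
    by (intro main[of \<Psi> "Suc (\<Sum>a\<in>A. \<rho> a)"] assms) force+
  then show ?thesis by (simp add: A_def F_def)
qed


section \<open>Substitution and determinants\<close>

lemma poly_mapping_eq_sum_single:
  assumes "finite A" "Poly_Mapping.keys P \<subseteq> A"
  shows "P = (\<Sum>m\<in>A. Poly_Mapping.single m (Poly_Mapping.lookup P m))"
proof (rule poly_mapping_eqI)
  fix k
  have "Poly_Mapping.lookup (\<Sum>m\<in>A. Poly_Mapping.single m (Poly_Mapping.lookup P m)) k =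
      (\<Sum>m\<in>A. if k = m then Poly_Mapping.lookup P m else 0)"
    by (auto simp: lookup_sum lookup_single when_def intro!: sum.cong)
  also have "\<dots> = Poly_Mapping.lookup P k"
    using assms by (auto simp: in_keys_iff)
  finally show "Poly_Mapping.lookup P k =
      Poly_Mapping.lookup (\<Sum>m\<in>A. Poly_Mapping.single m (Poly_Mapping.lookup P m)) k" ..
qed

lemma const_0 [simp]: "const 0 = 0"
  by (simp add: const_def)

lemma const_uminus: "const (- a) = - const a"
  by (simp add: const_def single_uminus)

lemma const_sum: "const (\<Sum>x\<in>A. f x) = (\<Sum>x\<in>A. const (f x))"
  by (induction A rule: infinite_finite_induct) (auto simp: const_add)

lemma const_prod: "const (\<Prod>x\<in>A. f x) = (\<Prod>x\<in>A. const (f x))"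
  by (induction A rule: infinite_finite_induct) (auto simp: const_mult const_1)

lemma const_of_nat: "const (of_nat n) = of_nat n"
  by (induction n) (auto simp: const_add const_1)

lemma const_of_int: "const (of_int n) = of_int n"
  by (cases n) (auto simp: const_of_nat const_uminus const_add const_1 simp flip: of_nat_Suc)

lemma lookup_const_mult:
  "Poly_Mapping.lookup (const c * P) m = c * Poly_Mapping.lookup P m"
proof -
  have "const c * P = Poly_Mapping.map ((*) c) P"
    by (simp add: const_def mult_map_scale_conv_mult)
  then show ?thesis by (simp add: Poly_Mapping.map.rep_eq when_def)
qed

definition monom_eval :: "(nat \<times> nat \<Rightarrow> dpoly poly) \<Rightarrow> ((nat \<times> nat) \<Rightarrow>\<^sub>0 nat) \<Rightarrow> dpoly poly" where
  "monom_eval f m = (\<Prod>v\<in>Poly_Mapping.keys m. f v ^ Poly_Mapping.lookup m v)"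

lemma monom_eval_superset:
  assumes "finite A" "Poly_Mapping.keys m \<subseteq> A"
  shows "monom_eval f m = (\<Prod>v\<in>A. f v ^ Poly_Mapping.lookup m v)"
  unfolding monom_eval_def using assms by (intro prod.mono_neutral_left) (auto simp: in_keys_iff)

lemma monom_eval_add: "monom_eval f (m + n) = monom_eval f m * monom_eval f n"
proof -
  let ?A = "Poly_Mapping.keys m \<union> Poly_Mapping.keys n"
  have "monom_eval f (m + n) = (\<Prod>v\<in>?A. f v ^ Poly_Mapping.lookup (m + n) v)"
    by (rule monom_eval_superset) (auto simp: Poly_Mapping.keys_add)
  also have "\<dots> = (\<Prod>v\<in>?A. f v ^ Poly_Mapping.lookup m v) * (\<Prod>v\<in>?A. f v ^ Poly_Mapping.lookup n v)"
    by (simp add: lookup_add power_add prod.distrib)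
  also have "\<dots> = monom_eval f m * monom_eval f n"
    by (simp add: monom_eval_superset[of ?A])
  finally show ?thesis .
qed

lemma subst_superset:
  assumes "finite A" "Poly_Mapping.keys P \<subseteq> A"
  shows "subst f P = (\<Sum>m\<in>A. [:const (Poly_Mapping.lookup P m):] * monom_eval f m)"
  unfolding subst_def monom_eval_def
  using assms by (intro sum.mono_neutral_left) (auto simp: in_keys_iff)

lemma subst_add: "subst f (P + Q) = subst f P + subst f Q"
proof -
  let ?A = "Poly_Mapping.keys P \<union> Poly_Mapping.keys Q"
  have "subst f (P + Q) = (\<Sum>m\<in>?A. [:const (Poly_Mapping.lookup (P + Q) m):] * monom_eval f m)"
    by (rule subst_superset) (auto simp: Poly_Mapping.keys_add)
  also have "\<dots> = (\<Sum>m\<in>?A. [:const (Poly_Mapping.lookup P m):] * monom_eval f m) +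
      (\<Sum>m\<in>?A. [:const (Poly_Mapping.lookup Q m):] * monom_eval f m)"
    by (simp add: lookup_add const_add sum.distrib smult_add_left)
  also have "\<dots> = subst f P + subst f Q"
    by (simp add: subst_superset[of ?A])
  finally show ?thesis .
qed

lemma subst_0: "subst f 0 = 0"
  by (simp add: subst_def)

lemma subst_sum: "subst f (\<Sum>x\<in>A. g x) = (\<Sum>x\<in>A. subst f (g x))"
  by (induction A rule: infinite_finite_induct) (auto simp: subst_0 subst_add)

lemma subst_single: "subst f (Poly_Mapping.single m c) = [:const c:] * monom_eval f m"
  by (subst subst_superset[of "{m}"]) auto

text \<open>Bilinearity reduces this to pairs of terms, where it is
  \<open>monom_eval_add\<close>.\<close>

lemma subst_mult: "subst f (P * Q) = subst f P * subst f Q"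
proof -
  let ?P = "\<lambda>m. Poly_Mapping.single m (Poly_Mapping.lookup P m)"
  let ?Q = "\<lambda>m. Poly_Mapping.single m (Poly_Mapping.lookup Q m)"
  have P: "P = (\<Sum>m\<in>Poly_Mapping.keys P. ?P m)" and Q: "Q = (\<Sum>n\<in>Poly_Mapping.keys Q. ?Q n)"
    by (rule poly_mapping_eq_sum_single; simp)+
  have single: "subst f (?P m * ?Q n) = subst f (?P m) * subst f (?Q n)" for m n
    by (simp add: mult_single subst_single monom_eval_add const_mult mult_ac)
  have "P * Q = (\<Sum>m\<in>Poly_Mapping.keys P. \<Sum>n\<in>Poly_Mapping.keys Q. ?P m * ?Q n)"
    unfolding sum_product[symmetric] by (rule arg_cong2[where f = "(*)", OF P Q])
  then have "subst f (P * Q) = (\<Sum>m\<in>Poly_Mapping.keys P. subst f (?P m)) * (\<Sum>n\<in>Poly_Mapping.keys Q. subst f (?Q n))"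
    by (simp only: subst_sum single sum_product)
  then show ?thesis
    by (simp only: subst_sum[symmetric] P[symmetric] Q[symmetric])
qed

lemma subst_const: "subst f (const c) = [:const c:]"
  by (subst const_def) (simp add: subst_single monom_eval_def)

lemma subst_X: "subst f (X i k) = f (i, k)"
  by (simp add: X_def subst_single monom_eval_def const_1)

lemma act_add: "act Q (P + R) = act Q P + act Q R"
  and act_0: "act Q 0 = 0"
  and act_sum: "act Q (\<Sum>x\<in>A. g x) = (\<Sum>x\<in>A. act Q (g x))"
  and act_mult: "act Q (P * R) = act Q P * act Q R"
  and act_const: "act Q (const c) = [:const c:]"
  and act_X: "act Q (X i k) = deriv_prod Q i k"
  by (simp_all add: act_def subst_add subst_0 subst_sum subst_mult subst_const subst_X)

lemma act_1: "act Q 1 = 1"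
  using act_const[of Q 1] by (simp add: const_1 one_pCons)

lemma comm_ring_hom_act: "comm_ring_hom (act Q)"
  by unfold_locales (simp_all add: act_add act_0 act_mult act_1)

text \<open>In the divided variables \<open>X\<^sub>i\<^sup>(\<^sup>s\<^sup>) / s!\<close> the Leibniz rule and the Wronskians lose
  their binomial coefficients.\<close>

definition dvar :: "nat \<Rightarrow> nat \<Rightarrow> dpoly" where
  "dvar i s = const (1 / fact s) * X i s"

lemma lift_poly_smult: "lift_poly (smult c Q) = smult (const c) (lift_poly Q)"
  by (rule poly_eqI) (simp add: lift_poly_def coeff_map_poly const_mult)

lemma lift_poly_0: "lift_poly 0 = 0"
  by (simp add: lift_poly_def)

text \<open>A plain convolution with the Taylor coefficients of \<open>Q\<close>, because
  binomial(s, j) / s! = 1 / ((s - j)! j!).\<close>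

lemma act_dvar:
  "act Q (dvar i s) =
    (\<Sum>j\<le>s. lift_poly (smult (1 / fact (s - j)) ((pderiv ^^ (s - j)) Q)) * [:dvar i j:])"
proof -
  have "act Q (dvar i s) = (\<Sum>j\<le>s. [:const (1 / fact s):] *
      (of_nat (s choose j) * lift_poly ((pderiv ^^ (s - j)) Q) * [:X i j:]))"
    by (simp add: dvar_def act_mult act_const act_X deriv_prod_def sum_distrib_left del: mult_pCons_left)
  also have "\<dots> = (\<Sum>j\<le>s. lift_poly (smult (1 / fact (s - j)) ((pderiv ^^ (s - j)) Q)) * [:dvar i j:])"
  proof (rule sum.cong[OF refl])
    fix j assume "j \<in> {..s}"
    then have "(1 / fact s :: complex) * of_nat (s choose j) = 1 / fact (s - j) * (1 / fact j)"
      by (simp add: binomial_fact)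
    then have "const (1 / fact s) * of_nat (s choose j) = const (1 / fact (s - j)) * const (1 / fact j)"
      by (metis const_mult const_of_nat)
    moreover have "[:const (1 / fact s):] * (of_nat (s choose j) * lift_poly ((pderiv ^^ (s - j)) Q) * [:X i j:]) =
      smult (const (1 / fact s) * of_nat (s choose j)) (lift_poly ((pderiv ^^ (s - j)) Q) * [:X i j:])"
      by (simp add: of_nat_poly mult_ac)
    ultimately show "[:const (1 / fact s):] * (of_nat (s choose j) * lift_poly ((pderiv ^^ (s - j)) Q) * [:X i j:]) =
      lift_poly (smult (1 / fact (s - j)) ((pderiv ^^ (s - j)) Q)) * [:dvar i j:]"
      by (simp add: lift_poly_smult dvar_def mult_ac)
  qed
  finally show ?thesis .
qed

section \<open>Determinants in the divided variables\<close>

text \<open>Column \<open>c\<close> lists the first \<open>d\<close> coefficients of the power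
  series t^{a_c} \<Sum>_s x_{i_c,s} t^s; the case distinction guards against truncated
  subtraction.\<close>

definition dvar_mat :: "nat \<Rightarrow> (nat \<Rightarrow> nat) \<Rightarrow> (nat \<Rightarrow> nat) \<Rightarrow> dpoly mat" where
  "dvar_mat d i a = mat d d (\<lambda>(r, c). if a c \<le> r then dvar (i c) (r - a c) else 0)"

definition dvar_det :: "nat \<Rightarrow> (nat \<Rightarrow> nat) \<Rightarrow> (nat \<Rightarrow> nat) \<Rightarrow> dpoly" where
  "dvar_det d i a = det (dvar_mat d i a)"

lemma dvar_mat_carrier: "dvar_mat d i a \<in> carrier_mat d d"
  by (simp add: dvar_mat_def)

lemma diff_homogeneous_dvar_det: "diff_homogeneous d (dvar_det d i a)"
  unfolding diff_homogeneous_def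
proof
  fix Q
  interpret act: comm_ring_hom "act Q" by (rule comm_ring_hom_act)
  interpret pc: comm_ring_hom "\<lambda>x. [:x:] :: dpoly poly"
    by unfold_locales (simp_all add: one_pCons)
  define q where "q k = lift_poly (smult (1 / fact k) ((pderiv ^^ k) Q))" for k
  define L where "L = mat d d (\<lambda>(r, s). if s \<le> r then q (r - s) else 0)"
  define M where "M = map_mat (\<lambda>x. [:x:]) (dvar_mat d i a)"
  have L: "L \<in> carrier_mat d d" and M: "M \<in> carrier_mat d d"
    by (simp_all add: L_def M_def dvar_mat_def)
  have "map_mat (act Q) (dvar_mat d i a) = L * M"
  proof (rule eq_matI)
    fix r c assume "r < dim_row (L * M)" "c < dim_col (L * M)"
    then have rc: "r < d" "c < d" using L M by auto
    have "(L * M) $$ (r, c) = (\<Sum>s = 0..<d. L $$ (r, s) * M $$ (s, c))"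
      using rc L M by (simp add: scalar_prod_def)
    \<comment> \<open>Row \<open>r\<close> of \<open>L\<close> vanishes beyond \<open>s = r\<close>,
      so cutting the power series off after \<open>d\<close> coefficients does not disturb the
      product.\<close>
    also have "\<dots> = (\<Sum>s = 0..<d. if s \<in> {a c..r} then q (r - s) * [:dvar (i c) (s - a c):] else 0)"
      by (rule sum.cong) (use rc in \<open>auto simp: L_def M_def dvar_mat_def\<close>)
    also have "\<dots> = (\<Sum>s\<in>{0..<d} \<inter> {a c..r}. q (r - s) * [:dvar (i c) (s - a c):])"
      by (simp only: sum.inter_restrict[OF finite_atLeastLessThan])
    also have "{0..<d} \<inter> {a c..r} = {a c..r}" using rc by auto
    also have "(\<Sum>s\<in>{a c..r}. q (r - s) * [:dvar (i c) (s - a c):]) = act Q (dvar_mat d i a $$ (r, c))"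
    proof (cases "a c \<le> r")
      case True
      have "(\<Sum>s\<in>{a c..r}. q (r - s) * [:dvar (i c) (s - a c):]) =
          (\<Sum>j\<le>r - a c. q (r - a c - j) * [:dvar (i c) j:])"
        by (rule sum.reindex_bij_witness[where i = "\<lambda>j. j + a c" and j = "\<lambda>s. s - a c"])
          (use True in \<open>auto simp: add.commute\<close>)
      then show ?thesis using rc True by (simp add: dvar_mat_def act_dvar q_def)
    qed (use rc in \<open>simp add: dvar_mat_def act_0\<close>)
    finally show "map_mat (act Q) (dvar_mat d i a) $$ (r, c) = (L * M) $$ (r, c)"
      using rc by (simp add: dvar_mat_def)
  qed (simp_all add: L_def M_def dvar_mat_def)
  then have "act Q (dvar_det d i a) = det (L * M)"
    by (simp add: dvar_det_def flip: act.hom_det)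
  also have "\<dots> = det L * det M" by (rule det_mult[OF L M])
  also have "det M = [:dvar_det d i a:]" by (simp add: M_def dvar_det_def pc.hom_det)
  also have "det L = prod_list (diag_mat L)"
    by (rule det_lower_triangular[OF _ L]) (simp add: L_def)
  also have "\<dots> = lift_poly Q ^ d"
    by (simp add: prod_list_diag_prod L_def q_def)
  finally show "act Q (dvar_det d i a) = lift_poly Q ^ d * [:dvar_det d i a:]" .
qed

lemma dvar_det_expand:
  "dvar_det d i a = (\<Sum>p | p permutes {..<d}. of_int (sign p) *
     (\<Prod>c<d. if a c \<le> p c then dvar (i c) (p c - a c) else 0))"
proof -
  have "dvar_det d i a = (\<Sum>p | p permutes {0..<d}. of_int (sign p) *
     (\<Prod>c<d. dvar_mat d i a $$ (p c, c)))"
    unfolding dvar_det_def by (rule det_col[OF dvar_mat_carrier])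
  also have "\<dots> = (\<Sum>p | p permutes {..<d}. of_int (sign p) *
     (\<Prod>c<d. if a c \<le> p c then dvar (i c) (p c - a c) else 0))"
  proof (intro sum.cong arg_cong2[where f = "(*)"] prod.cong refl)
    fix p c assume "p \<in> {p. p permutes {..<d}}" "c \<in> {..<d}"
    then have "p c < d" "c < d" using permutes_in_image[of p "{..<d}" c] by auto
    then show "dvar_mat d i a $$ (p c, c) = (if a c \<le> p c then dvar (i c) (p c - a c) else 0)"
      by (simp add: dvar_mat_def)
  qed (simp add: atLeast0LessThan)
  finally show ?thesis .
qed

text \<open>In the Leibniz formula the permutation p contributes the tuple r = p - a; collecting by
  \<open>r\<close> gives the sign of \<open>a + r\<close>. All orders that occur are below
  \<open>d\<close>, and a larger \<open>K\<close> lets the sum run over the same box as the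
  expansion of a given polynomial.\<close>

lemma dvar_det_eq_sum_perm_sign:
  assumes "d \<le> K"
  shows "dvar_det d i a = (\<Sum>r\<in>PiE {..<d} (\<lambda>_. {..<K}).
    const (perm_sign d (\<lambda>c. a c + r c)) * (\<Prod>c<d. dvar (i c) (r c)))"
proof -
  let ?B = "PiE {..<d} (\<lambda>_::nat. {..<K})"
  have *: "(\<Prod>c<d. if a c \<le> p c then dvar (i c) (p c - a c) else 0) =
      (\<Sum>r\<in>?B. of_bool (\<forall>c<d. a c + r c = p c) * (\<Prod>c<d. dvar (i c) (r c)))"
    if p: "p permutes {..<d}" for p
  proof -
    have "(\<Prod>c<d. if a c \<le> p c then dvar (i c) (p c - a c) else 0) =
        (\<Prod>c<d. \<Sum>s<K. if a c + s = p c then dvar (i c) s else 0)"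
    proof (rule prod.cong[OF refl])
      fix c assume "c \<in> {..<d}"
      then have "p c < d" using permutes_in_image[OF p, of c] by auto
      have "(\<Sum>s<K. if a c + s = p c then dvar (i c) s else 0) =
          (\<Sum>s<K. if s = p c - a c then if a c \<le> p c then dvar (i c) s else 0 else 0)"
        by (rule sum.cong) auto
      then show "(if a c \<le> p c then dvar (i c) (p c - a c) else 0) =
          (\<Sum>s<K. if a c + s = p c then dvar (i c) s else 0)"
        using \<open>p c < d\<close> assms by simp
    qed
    also have "\<dots> = (\<Sum>r\<in>?B. \<Prod>c<d. if a c + r c = p c then dvar (i c) (r c) else 0)"
      by (rule prod_sum_PiE) auto
    also have "\<dots> = (\<Sum>r\<in>?B. of_bool (\<forall>c<d. a c + r c = p c) * (\<Prod>c<d. dvar (i c) (r c)))"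
    proof (rule sum.cong[OF refl])
      fix r
      show "(\<Prod>c<d. if a c + r c = p c then dvar (i c) (r c) else 0) =
        of_bool (\<forall>c<d. a c + r c = p c) * (\<Prod>c<d. dvar (i c) (r c))"
        by (cases "\<forall>c<d. a c + r c = p c") (auto intro!: prod_zero)
    qed
    finally show ?thesis .
  qed
  have "dvar_det d i a = (\<Sum>p | p permutes {..<d}. \<Sum>r\<in>?B. of_int (sign p) *
      (of_bool (\<forall>c<d. a c + r c = p c) * (\<Prod>c<d. dvar (i c) (r c))))"
    unfolding dvar_det_expand by (intro sum.cong refl) (simp add: * sum_distrib_left)
  also have "\<dots> = (\<Sum>r\<in>?B. (\<Sum>p | p permutes {..<d}. of_int (sign p) *
      of_bool (\<forall>c<d. a c + r c = p c)) * (\<Prod>c<d. dvar (i c) (r c)))"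
    by (subst sum.swap) (simp add: sum_distrib_right mult.assoc)
  also have "\<dots> = (\<Sum>r\<in>?B. const (perm_sign d (\<lambda>c. a c + r c)) * (\<Prod>c<d. dvar (i c) (r c)))"
  proof (intro sum.cong refl arg_cong2[where f = "(*)"])
    fix r :: "nat \<Rightarrow> nat"
    show "(\<Sum>p | p permutes {..<d}. of_int (sign p) * of_bool (\<forall>c<d. a c + r c = p c)) =
        const (perm_sign d (\<lambda>c. a c + r c))"
      unfolding perm_sign_def const_sum const_mult const_of_int
      by (intro sum.cong refl arg_cong2[where f = "(*)"]) (simp add: const_1 of_bool_def)
  qed
  finally show ?thesis .
qed

text \<open>In this expansion \<open>a\<close> and \<open>r\<close> enter the coefficient only
  through their sum, so raising \<open>a\<close> acts like raising the argument of
  \<open>perm_sign\<close>.\<close>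

lemma coinvariant_dvar_det: "coinvariant d (dvar_det d i)"
proof -
  have 1: "coinvariant d (\<lambda>a. const (perm_sign d (\<lambda>c. a c + r c)))" for r
  proof -
    have "coinvariant d (\<lambda>a. perm_sign d (\<lambda>c. r c + a c))"
      by (rule coinvariant_add_left[OF coinvariant_perm_sign])
    then show ?thesis unfolding coinvariant_def by (simp add: add.commute flip: const_sum)
  qed
  have "dvar_det d i = (\<lambda>a. \<Sum>r\<in>PiE {..<d} (\<lambda>_. {..<d}).
      const (perm_sign d (\<lambda>c. a c + r c)) * (\<Prod>c<d. dvar (i c) (r c)))"
    by (rule ext) (rule dvar_det_eq_sum_perm_sign, simp)
  moreover have "coinvariant d \<dots>" by (rule coinvariant_sum_scaled) (rule 1)
  ultimately show ?thesis by (simp only:)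
qed

lemma dvar_det_comp:
  assumes q: "q permutes {..<d}"
  shows "dvar_det d (\<lambda>c. i (q c)) (\<lambda>c. a (q c)) = of_int (sign q) * dvar_det d i a"
proof -
  let ?F = "\<lambda>p. \<Prod>c<d. if a c \<le> p c then dvar (i c) (p c - a c) else 0"
  let ?G = "\<lambda>p. \<Prod>c<d. if a (q c) \<le> p c then dvar (i (q c)) (p c - a (q c)) else 0"
  have "dvar_det d (\<lambda>c. i (q c)) (\<lambda>c. a (q c)) =
      (\<Sum>p | p permutes {..<d}. of_int (sign (p \<circ> q)) * ?G (p \<circ> q))"
    unfolding dvar_det_expand by (rule sum.reindex_bij_betw[symmetric])
      (intro bij_betwI[where g = "\<lambda>p. p \<circ> inv_into UNIV q"];
       auto simp: permutes_compose permutes_inv q o_assoc[symmetric] permutes_inv_o[OF q])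
  also have "\<dots> = (\<Sum>p | p permutes {..<d}. of_int (sign q) * (of_int (sign p) * ?F p))"
  proof (rule sum.cong[OF refl])
    fix p assume "p \<in> {p. p permutes {..<d}}"
    then have p: "p permutes {..<d}" by simp
    have 1: "?G (p \<circ> q) = ?F p"
      using prod.reindex_bij_betw[OF permutes_imp_bij[OF q],
          of "\<lambda>c. if a c \<le> p c then dvar (i c) (p c - a c) else 0"] by (simp only: o_apply)
    have 2: "sign (p \<circ> q) = sign p * sign q"
      by (rule sign_compose) (use p q permutation_permutes in blast)+
    show "of_int (sign (p \<circ> q)) * ?G (p \<circ> q) = of_int (sign q) * (of_int (sign p) * ?F p)"
      unfolding 1 2 by simp
  qed
  finally show ?thesis by (simp add: dvar_det_expand sum_distrib_left)
qed

lemma dpoly_eq_uminus_imp_0: "P = 0" if "P = - P" for P :: dpoly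
proof (rule poly_mapping_eqI)
  fix m
  have "Poly_Mapping.lookup P m = - Poly_Mapping.lookup P m"
    using that by (metis lookup_uminus)
  then show "Poly_Mapping.lookup P m = Poly_Mapping.lookup 0 m" by simp
qed

text \<open>Exchanging two equal columns fixes the determinant and negates it.\<close>

lemma dvar_det_eq_0:
  assumes "u < d" "v < d" "u \<noteq> v" "i u = i v" "a u = a v"
  shows "dvar_det d i a = 0"
proof -
  have "dvar_det d i a = dvar_det d (\<lambda>c. i (transpose u v c)) (\<lambda>c. a (transpose u v c))"
    using assms by (intro arg_cong2[where f = "dvar_det d"]) (auto simp: transpose_def)
  also have "\<dots> = - dvar_det d i a"
    using assms by (subst dvar_det_comp) (auto simp: permutes_swap_id sign_swap_id)
  finally show ?thesis by (rule dpoly_eq_uminus_imp_0)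
qed


section \<open>Degrees and monomials\<close>

lemma prod_single:
  "(\<Prod>x\<in>A. Poly_Mapping.single (m x) (c x)) =
    Poly_Mapping.single (\<Sum>x\<in>A. m x) (\<Prod>x\<in>A. c x :: complex)"
  by (induction A rule: infinite_finite_induct) (auto simp: mult_single simp flip: single_one)

lemma const_power: "const (c ^ n) = const c ^ n"
  by (induction n) (auto simp: const_1 const_mult)

lemma X_power: "X i k ^ n = Poly_Mapping.single (Poly_Mapping.single (i, k) n) 1"
  by (induction n) (auto simp: X_def mult_single simp flip: single_add)

lemma deriv_prod_const: "deriv_prod [:c:] i k = [:const c * X i k:]"
proof -
  have "(pderiv ^^ Suc n) [:c:] = 0" for n
    by (induction n) auto
  then have "(pderiv ^^ (k - j)) [:c:] = 0" if "j < k" for j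
    using that by (metis Suc_diff_Suc)
  then have "deriv_prod [:c:] i k =
      (\<Sum>j\<le>k. if j = k then of_nat (k choose j) * lift_poly [:c:] * [:X i j:] else 0)"
    unfolding deriv_prod_def by (intro sum.cong) (auto simp: lift_poly_0)
  then show ?thesis by (simp add: lift_poly_def map_poly_pCons)
qed

lemma act_const_single:
  "act [:c:] (Poly_Mapping.single m b) =
    [:Poly_Mapping.single m (b * c ^ (\<Sum>v\<in>Poly_Mapping.keys m. Poly_Mapping.lookup m v)):]"
proof -
  let ?t = "\<Sum>v\<in>Poly_Mapping.keys m. Poly_Mapping.lookup m v"
  have *: "[:x:] ^ n = [:x ^ n:]" for x :: dpoly and n
    by (induction n) (auto simp: one_pCons)
  have **: "(\<Prod>v\<in>A. [:h v:]) = [:\<Prod>v\<in>A. h v:]" for A and h :: "nat \<times> nat \<Rightarrow> dpoly"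
    by (induction A rule: infinite_finite_induct) (auto simp: one_pCons)
  have "monom_eval (\<lambda>(i, k). deriv_prod [:c:] i k) m =
      [:\<Prod>v\<in>Poly_Mapping.keys m. (const c * X (fst v) (snd v)) ^ Poly_Mapping.lookup m v:]"
    by (simp add: monom_eval_def deriv_prod_const case_prod_unfold * **)
  also have "(\<Prod>v\<in>Poly_Mapping.keys m. (const c * X (fst v) (snd v)) ^ Poly_Mapping.lookup m v) =
      const c ^ ?t * (\<Prod>v\<in>Poly_Mapping.keys m. Poly_Mapping.single (Poly_Mapping.single v (Poly_Mapping.lookup m v)) 1)"
    by (simp add: power_mult_distrib prod.distrib X_power power_sum)
  also have "\<dots> = const c ^ ?t * Poly_Mapping.single m 1"
    by (simp add: prod_single flip: poly_mapping_eq_sum_single)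
  also have "const c ^ ?t = const (c ^ ?t)"
    by (rule const_power[symmetric])
  finally show ?thesis
    by (simp add: act_def subst_single const_def mult_single mult.commute)
qed

text \<open>The constant \<open>Q = 2\<close> multiplies a monomial of total degree t by 2^t,
  whereas homogeneity prescribes 2^d.\<close>

lemma diff_homogeneous_degree:
  assumes P: "diff_homogeneous d P" and m: "m \<in> Poly_Mapping.keys P"
  shows "(\<Sum>v\<in>Poly_Mapping.keys m. Poly_Mapping.lookup m v) = d"
proof -
  define t where "t m = (\<Sum>v\<in>Poly_Mapping.keys m. Poly_Mapping.lookup m v)"
    for m :: "(nat \<times> nat) \<Rightarrow>\<^sub>0 nat"
  let ?P = "\<lambda>m. Poly_Mapping.single m (Poly_Mapping.lookup P m)"
  let ?Q = "\<Sum>m\<in>Poly_Mapping.keys P. Poly_Mapping.single m (Poly_Mapping.lookup P m * 2 ^ t m)"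
  have sum_const: "(\<Sum>v\<in>A. [:h v:]) = [:\<Sum>v\<in>A. h v:]" for A and h :: "((nat \<times> nat) \<Rightarrow>\<^sub>0 nat) \<Rightarrow> dpoly"
    by (induction A rule: infinite_finite_induct) auto
  have "act [:2:] P = act [:2:] (\<Sum>m\<in>Poly_Mapping.keys P. ?P m)"
    using poly_mapping_eq_sum_single[of "Poly_Mapping.keys P" P] by simp
  also have "\<dots> = [:?Q:]"
    by (simp add: act_sum act_const_single t_def sum_const)
  also have "act [:2:] P = lift_poly [:2:] ^ d * [:P:]"
    using P by (simp add: diff_homogeneous_def)
  also have "lift_poly [:2:] ^ d = [:const (2 ^ d):]"
    by (induction d) (auto simp: lift_poly_def map_poly_pCons const_mult const_1 one_pCons)
  finally have "const (2 ^ d) * P = ?Q" by (simp add: mult.commute)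
  then have "2 ^ d * Poly_Mapping.lookup P m = Poly_Mapping.lookup ?Q m"
    by (simp flip: lookup_const_mult)
  also have "\<dots> = (\<Sum>n\<in>Poly_Mapping.keys P. if m = n then Poly_Mapping.lookup P n * 2 ^ t n else 0)"
    by (auto simp: lookup_sum lookup_single when_def intro!: sum.cong)
  also have "\<dots> = Poly_Mapping.lookup P m * 2 ^ t m" using m by simp
  finally have "(2 :: complex) ^ d = 2 ^ t m" using m by (simp add: in_keys_iff)
  then have "of_nat (2 ^ d) = (of_nat (2 ^ t m) :: complex)" by simp
  then have "(2::nat) ^ d = 2 ^ t m" by (simp only: of_nat_eq_iff)
  then show ?thesis by (simp add: t_def)
qed

text \<open>A monomial of degree \<open>d\<close> is presented by a tuple of indices and a tuple of
  orders, so that its factors have positions on which the operators y_c can act.\<close>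

definition monom_of :: "nat \<Rightarrow> (nat \<Rightarrow> nat) \<Rightarrow> (nat \<Rightarrow> nat) \<Rightarrow> (nat \<times> nat) \<Rightarrow>\<^sub>0 nat" where
  "monom_of d i r = (\<Sum>c<d. Poly_Mapping.single (i c, r c) 1)"

lemma prod_dvar:
  "(\<Prod>c<d. dvar (i c) (r c)) = Poly_Mapping.single (monom_of d i r) (1 / (\<Prod>c<d. fact (r c)))"
  by (simp add: dvar_def X_def const_def mult_single prod_single monom_of_def prod_dividef)

lemma lookup_monom_of:
  "Poly_Mapping.lookup (monom_of d i r) v = count (mset (map (\<lambda>c. (i c, r c)) [0..<d])) v"
  by (induction d) (auto simp: monom_of_def lookup_add lookup_single when_def)

lemma monom_of_cong:
  "(\<And>c. c < d \<Longrightarrow> i c = i' c) \<Longrightarrow> (\<And>c. c < d \<Longrightarrow> r c = r' c) \<Longrightarrow> monom_of d i r = monom_of d i' r'"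
  by (simp add: monom_of_def)

lemma keys_monom_of: "c < d \<Longrightarrow> (i c, r c) \<in> Poly_Mapping.keys (monom_of d i r)"
  by (auto simp: in_keys_iff lookup_monom_of count_eq_zero_iff)

text \<open>Exponents count occurrences of pairs, so equal monomials have the same multiset of pairs
  and their lists differ by a permutation.\<close>

lemma monom_of_eqE:
  assumes "monom_of d i r = monom_of d i' r'"
  obtains q where "q permutes {..<d}" "\<And>c. c < d \<Longrightarrow> i' c = i (q c)" "\<And>c. c < d \<Longrightarrow> r' c = r (q c)"
proof -
  let ?xs = "map (\<lambda>c. (i c, r c)) [0..<d]" and ?ys = "map (\<lambda>c. (i' c, r' c)) [0..<d]"
  have "mset ?ys = mset ?xs"
    by (intro multiset_eqI) (simp only: lookup_monom_of[symmetric] assms)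
  then obtain q where q: "q permutes {..<length ?xs}" "permute_list q ?xs = ?ys"
    by (rule mset_eq_permutation)
  have "i' c = i (q c) \<and> r' c = r (q c)" if c: "c < d" for c
  proof -
    have "q c < d" using permutes_in_image[OF q(1), of c] c by simp
    moreover have "?ys ! c = ?xs ! q c"
      using permute_list_nth[OF q(1), of c] c q(2) by simp
    ultimately show ?thesis using c by simp
  qed
  then show ?thesis using that q(1) by simp
qed

lemma monom_of_comp:
  assumes "q permutes {..<d}"
  shows "monom_of d (\<lambda>c. i (q c)) (\<lambda>c. r (q c)) = monom_of d i r"
  unfolding monom_of_def
  using sum.reindex_bij_betw[OF permutes_imp_bij[OF assms], of "\<lambda>c. Poly_Mapping.single (i c, r c) 1"]
  by (simp only:)

lemma ex_monom_of:
  assumes "(\<Sum>v\<in>Poly_Mapping.keys m. Poly_Mapping.lookup m v) = d"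
  obtains i r where "m = monom_of d i r"
proof -
  let ?M = "\<Sum>v\<in>Poly_Mapping.keys m. replicate_mset (Poly_Mapping.lookup m v) v"
  have cnt: "count ?M w = Poly_Mapping.lookup m w" for w
    by (simp add: count_sum) (simp add: in_keys_iff)
  obtain xs where xs: "mset xs = ?M" using ex_mset by blast
  have "length xs = size ?M" using xs by (metis size_mset)
  also have "\<dots> = d" using assms by (simp add: size_multiset_sum)
  finally have len: "length xs = d" .
  have "map (\<lambda>c. (fst (xs ! c), snd (xs ! c))) [0..<d] = xs"
    using len by (auto intro: nth_equalityI)
  then have "m = monom_of d (\<lambda>c. fst (xs ! c)) (\<lambda>c. snd (xs ! c))"
    by (intro poly_mapping_eqI) (simp add: lookup_monom_of xs cnt)
  then show ?thesis by (rule that)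
qed

text \<open>For Q = T only the Taylor coefficients T and 1 survive, so x_s becomes T x_s + x_{s-1},
  with x_{-1} = 0.\<close>

lemma act_X_dvar:
  "act [:0, 1:] (dvar i s) = [:if s = 0 then 0 else dvar i (s - 1), dvar i s:]"
proof -
  define q where "q k = lift_poly (smult (1 / fact k) ((pderiv ^^ k) [:0, 1:]))" for k
  have q0: "q 0 = [:0, 1:]" "q (Suc 0) = [:1:]"
    by (simp_all add: q_def lift_poly_def map_poly_pCons const_1 pderiv_pCons)
  have "(pderiv ^^ (Suc (Suc k))) [:0, 1 :: complex:] = 0" for k
    by (induction k) (auto simp: pderiv_pCons)
  then have q2: "q (Suc (Suc k)) = 0" for k
    unfolding q_def by (simp only: smult_0_right lift_poly_0)
  have expand: "act [:0, 1:] (dvar i s) = (\<Sum>j\<le>s. q (s - j) * [:dvar i j:])"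
    by (simp add: act_dvar q_def)
  show ?thesis
  proof (cases s)
    case 0
    then show ?thesis using expand by (simp add: q0)
  next
    case (Suc t)
    note expand
    also have "(\<Sum>j\<le>s. q (s - j) * [:dvar i j:]) = (\<Sum>j\<in>{t, Suc t}. q (s - j) * [:dvar i j:])"
    proof (rule sum.mono_neutral_right)
      show "\<forall>j\<in>{..s} - {t, Suc t}. q (s - j) * [:dvar i j:] = 0"
      proof
        fix j assume "j \<in> {..s} - {t, Suc t}"
        then have "j < t" using Suc by auto
        then have "s - j = Suc (Suc (t - j - 1))" using Suc by auto
        then show "q (s - j) * [:dvar i j:] = 0" by (simp only: q2) simp
      qed
    qed (auto simp: Suc)
    also have "\<dots> = [:dvar i t, dvar i s:]" by (simp add: Suc q0)
    finally show ?thesis by (simp add: Suc)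
  qed
qed


section \<open>Differentially homogeneous polynomials are spanned by determinants\<close>

text \<open>Expand the product of the factors T x_{r_c} + x_{r_c - 1}: \<open>S\<close> is the set
  of factors that contribute their lowered variable, and T occurs \<open>d - card S\<close>
  times.\<close>

lemma act_X_prod_dvar_coeff:
  assumes "j \<le> d"
  shows "poly.coeff (act [:0, 1:] (\<Prod>c<d. dvar (i c) (r c))) (d - j) =
    (\<Sum>S | S \<subseteq> {..<d} \<and> card S = j.
       \<Prod>c<d. if c \<in> S then if r c = 0 then 0 else dvar (i c) (r c - 1) else dvar (i c) (r c))"
proof -
  interpret act: comm_ring_hom "act [:0, 1:]" by (rule comm_ring_hom_act)
  let ?u = "\<lambda>c. if r c = 0 then 0 else dvar (i c) (r c - 1)"
  let ?t = "\<lambda>c. dvar (i c) (r c)"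
  let ?f = "\<lambda>S. \<Prod>c<d. if c \<in> S then ?u c else ?t c"
  have prod_pCons: "(\<Prod>c\<in>A. [:h c:]) = [:\<Prod>c\<in>A. h c:]" for A and h :: "nat \<Rightarrow> dpoly"
    by (induction A rule: infinite_finite_induct) (auto simp: one_pCons)
  have prod_monom: "(\<Prod>c\<in>A. [:0, h c:]) = monom (\<Prod>c\<in>A. h c) (card A)"
    if "finite A" for A and h :: "nat \<Rightarrow> dpoly"
    using that
  proof (induction A rule: finite_induct)
    case (insert x F)
    then show ?case by (simp add: monom_Suc smult_monom)
  qed (simp add: one_pCons monom_0)
  have "act [:0, 1:] (\<Prod>c<d. ?t c) = (\<Prod>c<d. [:?u c:] + [:0, ?t c:])"
    by (simp add: act.hom_prod act_X_dvar)
  also have "\<dots> = (\<Sum>S\<in>Pow {..<d}. (\<Prod>c\<in>S. [:?u c:]) * (\<Prod>c\<in>{..<d} - S. [:0, ?t c:]))"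
    by (rule prod_add) simp
  also have "\<dots> = (\<Sum>S\<in>Pow {..<d}. monom (?f S) (d - card S))"
  proof (rule sum.cong[OF refl])
    fix S assume "S \<in> Pow {..<d}"
    then have S: "S \<subseteq> {..<d}" "finite S" using finite_subset by auto
    have "?f S = (\<Prod>c\<in>{..<d} \<inter> S. ?u c) * (\<Prod>c\<in>{..<d} \<inter> - S. ?t c)"
      by (simp only: prod.If_cases[OF finite_lessThan] Collect_mem_eq)
    also have "{..<d} \<inter> S = S" using S by auto
    also have "{..<d} \<inter> - S = {..<d} - S" by auto
    finally have f: "?f S = (\<Prod>c\<in>S. ?u c) * (\<Prod>c\<in>{..<d} - S. ?t c)" .
    show "(\<Prod>c\<in>S. [:?u c:]) * (\<Prod>c\<in>{..<d} - S. [:0, ?t c:]) = monom (?f S) (d - card S)"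
      unfolding f prod_pCons prod_monom[OF finite_Diff[OF finite_lessThan]]
      using S by (simp add: smult_monom card_Diff_subset)
  qed
  finally have "poly.coeff (act [:0, 1:] (\<Prod>c<d. ?t c)) (d - j) =
      (\<Sum>S\<in>Pow {..<d}. if d - card S = d - j then ?f S else 0)"
    by (simp add: coeff_sum)
  also have "\<dots> = (\<Sum>S\<in>Pow {..<d}. if card S = j then ?f S else 0)"
  proof (rule sum.cong[OF refl])
    fix S assume "S \<in> Pow {..<d}"
    then have "card S \<le> d" using card_mono[of "{..<d}" S] by simp
    then have "d - card S = d - j \<longleftrightarrow> card S = j" using assms by auto
    then show "(if d - card S = d - j then ?f S else 0) = (if card S = j then ?f S else 0)"
      by simp
  qed
  also have "\<dots> = (\<Sum>S | S \<in> Pow {..<d} \<and> card S = j. ?f S)"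
    by (rule sum.inter_filter[symmetric]) simp
  finally show ?thesis by simp
qed

text \<open>\<open>P\<close> is written over tuples with coefficients \<open>\<beta> i r\<close>
  that depend only on the monomial. The lower coefficients of the action of T show that each
  \<open>\<beta> i\<close> is coinvariant, hence a combination of shifts of
  \<open>perm_sign\<close>, and such a shift is the coefficient function of a determinant.\<close>

lemma diff_homogeneous_in_span_dvar_det:
  assumes P: "P \<in> Vdiff N d"
  shows "P \<in> dp.span {dvar_det d i a | i a. i \<in> PiE {..<d} (\<lambda>_. {..N})}"
proof -
  have hom: "diff_homogeneous d P" and ind: "indets P \<subseteq> {..N} \<times> UNIV"
    using P by (auto simp: Vdiff_def diff_polys_def)
  have "finite (indets P)" by (auto simp: indets_def)
  then have "finite (snd ` indets P)" by simp
  then obtain K0 where K0: "snd ` indets P \<subseteq> {..<K0}"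
    using finite_nat_iff_bounded by blast
  \<comment> \<open>\<open>K\<close> bounds all orders occurring in \<open>P\<close> and is at least
    \<open>d\<close>, as the expansion of the determinants requires.\<close>
  define K where "K = max d K0"
  have dK: "d \<le> K" and K: "indets P \<subseteq> {..N} \<times> {..<K}"
    using ind K0 by (force simp: K_def)+
  define I where "I = PiE {..<d} (\<lambda>_. {..N})"
  define R where "R = PiE {..<d} (\<lambda>_. {..<K})"
  have fin: "finite I" "finite R" by (auto simp: I_def R_def intro: finite_PiE)
  define fib where "fib m = {z \<in> I \<times> R. monom_of d (fst z) (snd z) = m}" for m
  have finfib: "finite (fib m)" for m using fin by (simp add: fib_def)
  \<comment> \<open>Dividing by the size of the fibre spreads the coefficient of a monomial evenly over the
    tuples \<open>(i, r)\<close> representing it; the factorials account for the divided variables.\<close>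
  define \<beta> where "\<beta> i r = Poly_Mapping.lookup P (monom_of d i r) * (\<Prod>c<d. fact (r c)) /
      of_nat (card (fib (monom_of d i r)))" for i r
  define dprod where "dprod i r = (\<Prod>c<d. dvar (i c) (r c))" for i r
  have \<beta>_eq: "\<beta> i r = \<beta> i' r'" if "monom_of d i r = monom_of d i' r'" for i r i' r'
  proof -
    obtain q where q: "q permutes {..<d}" "\<And>c. c < d \<Longrightarrow> r' c = r (q c)"
      using monom_of_eqE[OF \<open>monom_of d i r = monom_of d i' r'\<close>] by blast
    have "(\<Prod>c<d. fact (r' c) :: complex) = (\<Prod>c<d. fact (r (q c)))"
      by (intro prod.cong) (use q in auto)
    also have "\<dots> = (\<Prod>c<d. fact (r c))"
      using prod.reindex_bij_betw[OF permutes_imp_bij[OF q(1)], of "\<lambda>c. fact (r c)"] .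
    finally show ?thesis using that by (simp add: \<beta>_def)
  qed
  have \<beta>_out: "\<beta> i r = 0" if "c < d" "K \<le> r c" for i r c
  proof -
    have "monom_of d i r \<notin> Poly_Mapping.keys P"
      using keys_monom_of[OF that(1), of i r] K that(2) by (force simp: indets_def)
    then show ?thesis by (simp add: \<beta>_def in_keys_iff)
  qed
  have const_dprod: "const b * dprod i r = Poly_Mapping.single (monom_of d i r) (b / (\<Prod>c<d. fact (r c)))"
    for b i r by (simp add: dprod_def prod_dvar const_def mult_single)
  \<comment> \<open>Stated for arbitrary coefficients: with \<open>\<beta>\<close> it recovers
    \<open>P\<close>, with \<open>\<gamma>\<close> it splits the relation
    \<open>\<gamma>_sum\<close> by monomials.\<close>
  have lookup_sum_dprod: "Poly_Mapping.lookup (\<Sum>i\<in>I. \<Sum>r\<in>R. const (h i r) * dprod i r) m =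
      (\<Sum>z\<in>fib m. h (fst z) (snd z) / (\<Prod>c<d. fact (snd z c)))" for h m
  proof -
    have "Poly_Mapping.lookup (\<Sum>i\<in>I. \<Sum>r\<in>R. const (h i r) * dprod i r) m =
        (\<Sum>z\<in>I \<times> R. if monom_of d (fst z) (snd z) = m
          then h (fst z) (snd z) / (\<Prod>c<d. fact (snd z c)) else 0)"
      by (simp add: sum.cartesian_product lookup_sum const_dprod lookup_single when_def case_prod_unfold)
    then show ?thesis by (simp add: fib_def fin sum.inter_filter)
  qed
  have P_eq: "P = (\<Sum>i\<in>I. \<Sum>r\<in>R. const (\<beta> i r) * dprod i r)"
  proof (rule poly_mapping_eqI)
    fix m
    have "(\<Prod>c<d. fact (r c) :: complex) \<noteq> 0" for r :: "nat \<Rightarrow> nat" by simp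
    then have "Poly_Mapping.lookup (\<Sum>i\<in>I. \<Sum>r\<in>R. const (\<beta> i r) * dprod i r) m =
        (\<Sum>z\<in>fib m. Poly_Mapping.lookup P m / of_nat (card (fib m)))"
      unfolding lookup_sum_dprod by (intro sum.cong refl) (auto simp: \<beta>_def fib_def)
    also have "\<dots> = Poly_Mapping.lookup P m"
    proof (cases "fib m = {}")
      case True
      \<comment> \<open>Every monomial of \<open>P\<close> has degree \<open>d\<close>, indices at
        most \<open>N\<close> and orders below \<open>K\<close>, so it has a nonempty fibre.\<close>
      have "m \<notin> Poly_Mapping.keys P"
      proof
        assume m: "m \<in> Poly_Mapping.keys P"
        obtain i r where ir: "m = monom_of d i r"
          using ex_monom_of[OF diff_homogeneous_degree[OF hom m]] by blast
        have *: "i c \<le> N \<and> r c < K" if "c < d" for c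
          using keys_monom_of[OF that, of i r] K m ir by (force simp: indets_def)
        have "m = monom_of d (restrict i {..<d}) (restrict r {..<d})"
          unfolding ir by (rule monom_of_cong) auto
        then have "(restrict i {..<d}, restrict r {..<d}) \<in> fib m"
          using * by (auto simp: fib_def I_def R_def)
        then show False using True by simp
      qed
      then show ?thesis using True by (simp add: in_keys_iff)
    next
      case False
      then have "card (fib m) \<noteq> 0" using finfib by simp
      then show ?thesis by simp
    qed
    finally show "Poly_Mapping.lookup P m = Poly_Mapping.lookup (\<Sum>i\<in>I. \<Sum>r\<in>R. const (\<beta> i r) * dprod i r) m" ..
  qed
  \<comment> \<open>This is e_j(y) applied to \<open>\<beta> i\<close>; the aim is to show that it
    vanishes.\<close>
  define \<gamma> where "\<gamma> j i r = (\<Sum>S | S \<subseteq> {..<d} \<and> card S = j. \<beta> i (raise S r))" for j i r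
  \<comment> \<open>The contribution of a tuple to its monomial is constant on the fibre, because a
    permutation of the positions only permutes the sets \<open>S\<close>. Hence a vanishing
    coefficient of the monomial forces every contribution to vanish.\<close>
  have \<gamma>_eq: "\<gamma> j i r / (\<Prod>c<d. fact (r c)) = \<gamma> j i' r' / (\<Prod>c<d. fact (r' c))"
    if m: "monom_of d i r = monom_of d i' r'" for j i r i' r'
  proof -
    obtain q where q: "q permutes {..<d}" "\<And>c. c < d \<Longrightarrow> i' c = i (q c)" "\<And>c. c < d \<Longrightarrow> r' c = r (q c)"
      using monom_of_eqE[OF m] by blast
    have "(\<Prod>c<d. fact (r' c) :: complex) = (\<Prod>c<d. fact (r (q c)))"
      by (intro prod.cong) (use q in auto)
    also have "\<dots> = (\<Prod>c<d. fact (r c))"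
      using prod.reindex_bij_betw[OF permutes_imp_bij[OF q(1)], of "\<lambda>c. fact (r c)"] .
    finally have 1: "(\<Prod>c<d. fact (r' c) :: complex) = (\<Prod>c<d. fact (r c))" .
    have inj: "inj q" using q(1) by (rule permutes_inj)
    have "\<beta> i' (raise S r') = \<beta> i (raise (q ` S) r)" for S
    proof (rule \<beta>_eq)
      have "monom_of d i' (raise S r') =
          monom_of d (\<lambda>c. i (q c)) (\<lambda>c. raise (q ` S) r (q c))"
        by (rule monom_of_cong) (auto simp: q raise_def inj_image_mem_iff[OF inj])
      then show "monom_of d i' (raise S r') = monom_of d i (raise (q ` S) r)"
        by (simp only: monom_of_comp[OF q(1)])
    qed
    then have "\<gamma> j i' r' = (\<Sum>S | S \<subseteq> {..<d} \<and> card S = j. \<beta> i (raise (q ` S) r))"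
      by (simp add: \<gamma>_def)
    also have "\<dots> = \<gamma> j i r" unfolding \<gamma>_def
    proof (rule sum.reindex_bij_betw, rule bij_betwI[where g = "\<lambda>S. inv_into UNIV q ` S"])
      have im: "p ` S \<subseteq> {..<d} \<and> card (p ` S) = j" if "p permutes {..<d}" "S \<subseteq> {..<d}" "card S = j" for p S
        using image_mono[OF that(2), of p] permutes_image[OF that(1)]
          card_image[OF permutes_inj_on[OF that(1)], of S] that(3) by simp
      show "(`) q \<in> {S. S \<subseteq> {..<d} \<and> card S = j} \<rightarrow> {S. S \<subseteq> {..<d} \<and> card S = j}"
        using im[OF q(1)] by auto
      show "(\<lambda>S. inv_into UNIV q ` S) \<in> {S. S \<subseteq> {..<d} \<and> card S = j} \<rightarrow> {S. S \<subseteq> {..<d} \<and> card S = j}"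
        using im[OF permutes_inv[OF q(1)]] by auto
    qed (simp_all add: image_image permutes_inverses[OF q(1)])
    finally show ?thesis using 1 by simp
  qed
  have \<gamma>_sum: "(\<Sum>i\<in>I. \<Sum>r\<in>R. const (\<gamma> j i r) * dprod i r) = 0" if j: "1 \<le> j" "j \<le> d" for j
  proof -
    let ?A = "{S. S \<subseteq> {..<d} \<and> card S = j}"
    let ?low = "\<lambda>i r S. \<Prod>c<d. if c \<in> S then if r c = 0 then 0 else dvar (i c) (r c - 1) else dvar (i c) (r c)"
    have finA: "finite ?A" by (rule finite_subset[of _ "Pow {..<d}"]) auto
    have "lift_poly [:0, 1:] ^ d = monom 1 d"
      by (induction d) (auto simp: lift_poly_def map_poly_pCons const_1 one_pCons monom_0 monom_Suc)
    then have "act [:0, 1:] P = monom P d"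
      using hom by (simp add: diff_homogeneous_def smult_monom)
    \<comment> \<open>T acts on \<open>P\<close> as multiplication by T^d, so the coefficient of
      T^{d-j} is 0.\<close>
    then have "0 = poly.coeff (act [:0, 1:] P) (d - j)" using j by auto
    also have "\<dots> = (\<Sum>i\<in>I. \<Sum>r\<in>R. const (\<beta> i r) * poly.coeff (act [:0, 1:] (dprod i r)) (d - j))"
      by (subst P_eq) (simp add: act_sum act_mult act_const coeff_sum)
    also have "\<dots> = (\<Sum>i\<in>I. \<Sum>r\<in>R. \<Sum>S\<in>?A. const (\<beta> i r) * ?low i r S)"
      by (simp only: dprod_def act_X_prod_dvar_coeff[OF j(2)] sum_distrib_left)
    also have "\<dots> = (\<Sum>i\<in>I. \<Sum>S\<in>?A. \<Sum>r\<in>R. const (\<beta> i r) * ?low i r S)"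
      by (intro sum.cong refl sum.swap)
    \<comment> \<open>Substituting \<open>r = raise S w\<close> moves the lowering of the variables
      to a raising of the argument of \<open>\<beta>\<close>. Tuples with a zero entry on
      \<open>S\<close> have no such \<open>w\<close>, and their terms vanish.\<close>
    also have "\<dots> = (\<Sum>i\<in>I. \<Sum>S\<in>?A. \<Sum>w\<in>R. const (\<beta> i (raise S w)) * dprod i w)"
    proof (rule sum.cong[OF refl], rule sum.cong[OF refl])
      fix i S assume "S \<in> ?A"
      then have S: "S \<subseteq> {..<d}" by simp
      have "(\<Sum>r\<in>R. const (\<beta> i r) * ?low i r S) =
          (\<Sum>r | r \<in> R \<and> (\<forall>c\<in>S. r c \<noteq> 0). const (\<beta> i r) * ?low i r S)"
      proof (rule sum.mono_neutral_right)
        show "\<forall>r\<in>R - {r \<in> R. \<forall>c\<in>S. r c \<noteq> 0}. const (\<beta> i r) * ?low i r S = 0"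
        proof
          fix r assume "r \<in> R - {r \<in> R. \<forall>c\<in>S. r c \<noteq> 0}"
          then obtain c where "c \<in> S" "r c = 0" by auto
          then have "?low i r S = 0" using S by (intro prod_zero) auto
          then show "const (\<beta> i r) * ?low i r S = 0" by simp
        qed
      qed (use fin in auto)
      also have "\<dots> = (\<Sum>w | w \<in> R \<and> raise S w \<in> R. const (\<beta> i (raise S w)) * dprod i w)"
      proof (rule sum.reindex_bij_witness[where i = "raise S" and j = "\<lambda>r c. if c \<in> S then r c - 1 else r c"],
          goal_cases)
        case (1 r)
        then show ?case by (auto simp: raise_def fun_eq_iff)
      next
        case (2 r)
        then have "raise S (\<lambda>c. if c \<in> S then r c - 1 else r c) = r"
          by (auto simp: raise_def fun_eq_iff)
        moreover have "(\<lambda>c. if c \<in> S then r c - 1 else r c) \<in> R"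
          using 2 S by (force simp: R_def PiE_iff extensional_def)
        ultimately show ?case using 2 by simp
      next
        case (3 w)
        then show ?case by (auto simp: raise_def fun_eq_iff)
      next
        case (4 w)
        then show ?case by (auto simp: raise_def)
      next
        case (5 r)
        then have "raise S (\<lambda>c. if c \<in> S then r c - 1 else r c) = r"
          by (auto simp: raise_def fun_eq_iff)
        moreover have "dprod i (\<lambda>c. if c \<in> S then r c - 1 else r c) = ?low i r S"
          unfolding dprod_def by (rule prod.cong) (use 5 in auto)
        ultimately show ?case by simp
      qed
      \<comment> \<open>Where raising leaves the box, some order reaches \<open>K\<close> and
        \<open>\<beta>\<close> is 0.\<close>
      also have "\<dots> = (\<Sum>w\<in>R. const (\<beta> i (raise S w)) * dprod i w)"
      proof (rule sum.mono_neutral_left)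
        show "\<forall>w\<in>R - {w \<in> R. raise S w \<in> R}. const (\<beta> i (raise S w)) * dprod i w = 0"
        proof
          fix w assume w: "w \<in> R - {w \<in> R. raise S w \<in> R}"
          then have "raise S w \<notin> R" by simp
          have "raise S w \<in> extensional {..<d}"
            using w S by (auto simp: R_def PiE_iff raise_def extensional_def)
          then obtain c where "c < d" "K \<le> raise S w c"
            using \<open>raise S w \<notin> R\<close> by (auto simp: R_def PiE_iff not_less)
          then show "const (\<beta> i (raise S w)) * dprod i w = 0" by (simp add: \<beta>_out)
        qed
      qed (use fin in auto)
      finally show "(\<Sum>r\<in>R. const (\<beta> i r) * ?low i r S) = (\<Sum>w\<in>R. const (\<beta> i (raise S w)) * dprod i w)" .
    qed
    also have "\<dots> = (\<Sum>i\<in>I. \<Sum>w\<in>R. \<Sum>S\<in>?A. const (\<beta> i (raise S w)) * dprod i w)"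
      by (intro sum.cong refl sum.swap)
    also have "\<dots> = (\<Sum>i\<in>I. \<Sum>r\<in>R. const (\<gamma> j i r) * dprod i r)"
      by (simp add: \<gamma>_def const_sum sum_distrib_right)
    finally show ?thesis by simp
  qed
  \<comment> \<open>Coinvariance speaks of all \<open>r\<close>, whereas \<open>\<gamma>_sum\<close>
    only sees the box: an entry of at least \<open>K\<close> stays so under raising and kills all
    terms.\<close>
  have \<gamma>_0: "\<gamma> j i r = 0" if j: "1 \<le> j" and i: "i \<in> I" for j i r
  proof (cases "j \<le> d")
    case False
    have "{S. S \<subseteq> {..<d} \<and> card S = j} = {}"
      using card_mono[of "{..<d}"] False by fastforce
    then show ?thesis by (simp only: \<gamma>_def sum.empty)
  next
    case True
    show ?thesis
    proof (cases "\<exists>c<d. K \<le> r c")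
      case True
      then obtain c where "c < d" "K \<le> r c" by blast
      then show ?thesis unfolding \<gamma>_def
        by (intro sum.neutral ballI \<beta>_out[of c]) (auto simp: raise_def)
    next
      case False
      \<comment> \<open>Members of \<open>R\<close> are \<open>undefined\<close> outside
        \<open>{..<d}\<close>; restricting \<open>r\<close> to \<open>{..<d}\<close> does not change
        \<open>\<gamma>\<close>.\<close>
      define w where "w = restrict r {..<d}"
      have w: "w \<in> R" using False by (auto simp: w_def R_def not_le)
      have "\<beta> i (raise S w) = \<beta> i (raise S r)" for S
        by (intro \<beta>_eq monom_of_cong) (auto simp: w_def raise_def)
      then have "\<gamma> j i r = \<gamma> j i w" by (simp add: \<gamma>_def)
      moreover have "\<gamma> j i w = 0"
      proof -
        let ?m = "monom_of d i w"
        have "0 = (\<Sum>z\<in>fib ?m. \<gamma> j (fst z) (snd z) / (\<Prod>c<d. fact (snd z c)))"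
          using \<gamma>_sum[OF j True] lookup_sum_dprod[of "\<gamma> j" ?m] by simp
        also have "\<dots> = (\<Sum>z\<in>fib ?m. \<gamma> j i w / (\<Prod>c<d. fact (w c)))"
          by (intro sum.cong refl \<gamma>_eq) (simp add: fib_def)
        also have "\<dots> = of_nat (card (fib ?m)) * (\<gamma> j i w / (\<Prod>c<d. fact (w c)))" by simp
        finally have "card (fib ?m) = 0 \<or> \<gamma> j i w = 0" by simp
        moreover have "(i, w) \<in> fib ?m" using i w by (simp add: fib_def)
        then have "card (fib ?m) \<noteq> 0" using finfib by auto
        ultimately show ?thesis by simp
      qed
      ultimately show ?thesis by simp
    qed
  qed
  have in_span: "(\<Sum>r\<in>R. const (\<beta> i r) * dprod i r) \<in> dp.span {dvar_det d i a | i a. i \<in> I}" if i: "i \<in> I" for i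
  proof -
    have "\<exists>g. \<forall>r. \<beta> i r = (\<Sum>a\<in>PiE {..<d} (\<lambda>c. {..c}). perm_sign d (\<lambda>c. c - a c + r c) * g a)"
    proof (rule coinvariant_spanned)
      show "coinvariant d (\<beta> i)"
        using \<gamma>_0[OF _ i] by (simp add: coinvariant_def \<gamma>_def)
      show "\<beta> i r = \<beta> i r'" if "\<And>c. c < d \<Longrightarrow> r c = r' c" for r r'
        by (intro \<beta>_eq monom_of_cong that refl)
    qed
    then obtain g where g: "\<And>r. \<beta> i r =
        (\<Sum>a\<in>PiE {..<d} (\<lambda>c. {..c}). perm_sign d (\<lambda>c. c - a c + r c) * g a)" by blast
    have "(\<Sum>r\<in>R. const (\<beta> i r) * dprod i r) =
        (\<Sum>r\<in>R. \<Sum>a\<in>PiE {..<d} (\<lambda>c. {..c}). const (g a) * (const (perm_sign d (\<lambda>c. c - a c + r c)) * dprod i r))"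
      by (simp only: g const_sum const_mult sum_distrib_right) (simp only: mult_ac)
    \<comment> \<open>The shift by \<open>c - a c\<close> is the coefficient function of the
      determinant with exponents \<open>c - a c\<close>.\<close>
    also have "\<dots> = (\<Sum>a\<in>PiE {..<d} (\<lambda>c. {..c}). scale (g a) (dvar_det d i (\<lambda>c. c - a c)))"
      by (subst sum.swap) (simp add: scale_def dvar_det_eq_sum_perm_sign[OF dK] R_def dprod_def sum_distrib_left)
    also have "\<dots> \<in> dp.span {dvar_det d i a | i a. i \<in> I}"
      using i by (intro dp.span_sum dp.span_scale dp.span_base) blast
    finally show ?thesis .
  qed
  have "(\<Sum>i\<in>I. \<Sum>r\<in>R. const (\<beta> i r) * dprod i r) \<in> dp.span {dvar_det d i a | i a. i \<in> I}"
    by (intro dp.span_sum in_span)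
  then show ?thesis using P_eq by (simp add: I_def)
qed


section \<open>The data indexing the basis\<close>

lemma poly_lift_poly_0: "poly (lift_poly Q) 0 = const (poly.coeff Q 0)"
  by (simp add: lift_poly_def poly_0_coeff_0 coeff_map_poly)

text \<open>At t = 0 only the \<open>a\<close>-th derivative of t^a survives, with value a!, which
  leaves the term j = r - a; its coefficient is r! / (r - a)!.\<close>

lemma poly_deriv_prod_monom_0:
  "poly (deriv_prod (monom 1 a) i r) 0 = (if a \<le> r then const (fact r) * dvar i (r - a) else 0)"
proof -
  have c: "poly.coeff ((pderiv ^^ n) (monom 1 a)) 0 = (if a = n then fact n else 0 :: complex)" for n
    by (simp add: coeff_higher_pderiv pochhammer_fact)
  have "poly (deriv_prod (monom 1 a) i r) 0 =
      (\<Sum>j\<le>r. if a = r - j then const (of_nat (r choose j) * fact (r - j)) * X i j else 0)"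
    by (auto simp: deriv_prod_def poly_sum poly_lift_poly_0 c const_mult const_of_nat of_nat_poly
        intro!: sum.cong)
  also have "\<dots> = (\<Sum>j\<le>r. if j = r - a then if a \<le> r then const (of_nat (r choose j) * fact (r - j)) * X i j else 0 else 0)"
    by (rule sum.cong) auto
  also have "\<dots> = (if a \<le> r then const (of_nat (r choose (r - a)) * fact a) * X i (r - a) else 0)"
    by simp
  also have "\<dots> = (if a \<le> r then const (fact r) * dvar i (r - a) else 0)"
  proof (cases "a \<le> r")
    case True
    then have eq: "(of_nat (r choose (r - a)) * fact a :: complex) = fact r * (1 / fact (r - a))"
      by (simp add: binomial_fact)
    have "const (of_nat (r choose (r - a)) * fact a) = const (fact r) * const (1 / fact (r - a))"
      unfolding eq by (rule const_mult)
    then show ?thesis using True by (simp only: if_True dvar_def mult.assoc)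
  qed simp
  finally show ?thesis .
qed

text \<open>Row \<open>r\<close> of the Wronskian matrix at 0 is r! times row \<open>r\<close> of
  \<open>dvar_mat\<close>.\<close>

lemma wronsk_monom:
  assumes "length L = d"
  shows "wronsk (map (\<lambda>(i, a). (monom 1 a, i)) L) =
    scale (\<Prod>r<d. fact r) (dvar_det d (\<lambda>c. fst (L ! c)) (\<lambda>c. snd (L ! c)))"
proof -
  interpret ev: comm_ring_hom "\<lambda>p :: dpoly poly. poly p 0"
    by unfold_locales simp_all
  let ?M = "dvar_mat d (\<lambda>c. fst (L ! c)) (\<lambda>c. snd (L ! c))"
  let ?A = "mat d d (\<lambda>(r, c). const (fact r) * ?M $$ (r, c))"
  have "wronsk (map (\<lambda>(i, a). (monom 1 a, i)) L) =
      det (map_mat (\<lambda>p. poly p 0) (mat d d (\<lambda>(r, k). deriv_prod (monom 1 (snd (L ! k))) (fst (L ! k)) r)))"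
    unfolding ev.hom_det wronsk_def
    by (intro arg_cong2[where f = poly] arg_cong[where f = det] refl)
      (auto simp: assms case_prod_unfold)
  also have "map_mat (\<lambda>p. poly p 0) (mat d d (\<lambda>(r, k). deriv_prod (monom 1 (snd (L ! k))) (fst (L ! k)) r)) = ?A"
    by (rule eq_matI) (auto simp: poly_deriv_prod_monom_0 dvar_mat_def)
  also have "det ?A = (\<Sum>p | p permutes {0..<d}. of_int (sign p) * (\<Prod>r = 0..<d. ?A $$ (r, p r)))"
    by (rule det_def') simp
  also have "\<dots> = (\<Sum>p | p permutes {0..<d}. (\<Prod>r<d. const (fact r)) * (of_int (sign p) * (\<Prod>r = 0..<d. ?M $$ (r, p r))))"
  proof (rule sum.cong[OF refl])
    fix p assume "p \<in> {p. p permutes {0..<d}}"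
    then have "p r < d" if "r < d" for r using permutes_in_image[of p "{0..<d}" r] that by auto
    then have "(\<Prod>r = 0..<d. ?A $$ (r, p r)) = (\<Prod>r = 0..<d. const (fact r) * ?M $$ (r, p r))"
      by (intro prod.cong) auto
    then show "of_int (sign p) * (\<Prod>r = 0..<d. ?A $$ (r, p r)) =
        (\<Prod>r<d. const (fact r)) * (of_int (sign p) * (\<Prod>r = 0..<d. ?M $$ (r, p r)))"
      by (simp add: prod.distrib atLeast0LessThan mult_ac)
  qed
  also have "\<dots> = scale (\<Prod>r<d. fact r) (det ?M)"
    by (simp add: scale_def const_prod sum_distrib_left det_def'[OF dvar_mat_carrier])
  finally show ?thesis by (simp add: dvar_det_def)
qed

text \<open>A datum is recorded by its set of pairs \<open>(i, \<alpha>\<^sub>i\<^sub>,\<^sub>j)\<close>, with \<open>i < n = N + 1\<close>; allowing \<open>n = 0\<close>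
  gives the count \<open>n\<^sup>d\<close> an easy induction on \<open>n\<close>.\<close>

definition wronsk_sets :: "nat \<Rightarrow> nat \<Rightarrow> (nat \<times> nat) set set" where
  "wronsk_sets n d = {A. finite A \<and> card A = d \<and>
     (\<forall>x\<in>A. fst x < n \<and> snd x < card {y \<in> A. fst y \<le> fst x})}"

lemma wronsk_setsD:
  assumes "A \<in> wronsk_sets n d"
  shows "finite A" "card A = d" "(i, a) \<in> A \<Longrightarrow> i < n"
    "(i, a) \<in> A \<Longrightarrow> a < card {y \<in> A. fst y \<le> i}"
  using assms unfolding wronsk_sets_def by fastforce+

text \<open>The fibre over \<open>j\<close> has size m_j, so the bound in \<open>wronsk_sets\<close>
  is the partial sum in \<open>wronsk_data\<close>.\<close>

lemma card_fst_le:
  assumes "finite A"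
  shows "card {y \<in> A. fst y \<le> (i::nat)} = (\<Sum>j\<le>i. card {a. (j, a) \<in> A})"
proof -
  have fin: "finite {a. (j, a) \<in> A}" for j
    by (rule finite_subset[of _ "snd ` A"]) (use assms in force)+
  have "{y \<in> A. fst y \<le> i} = (SIGMA j:{..i}. {a. (j, a) \<in> A})" by auto
  then show ?thesis using fin by simp
qed

text \<open>For pairs of the top index \<open>n\<close> the bound is the full size \<open>d\<close>,
  so their second components form an arbitrary subset \<open>B\<close> of \<open>{..<d}\<close>; the
  bounds for the other pairs do not involve \<open>B\<close>.\<close>

lemma wronsk_sets_Suc:
  "bij_betw (\<lambda>(B, A). A \<union> Pair n ` B)
     (SIGMA B:Pow {..<d}. wronsk_sets n (d - card B)) (wronsk_sets (Suc n) d)"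
proof (rule bij_betwI[where g = "\<lambda>A. ({a. (n, a) \<in> A}, {y \<in> A. fst y < n})"])
  show "(\<lambda>(B, A). A \<union> Pair n ` B) \<in>
      (SIGMA B:Pow {..<d}. wronsk_sets n (d - card B)) \<rightarrow> wronsk_sets (Suc n) d"
  proof (clarify)
    fix B A assume B: "B \<subseteq> {..<d}" and A: "A \<in> wronsk_sets n (d - card B)"
    note A = wronsk_setsD[OF A]
    let ?C = "A \<union> Pair n ` B"
    have finB: "finite B" using B finite_subset by auto
    have cB: "card B \<le> d" using card_mono[OF _ B] by simp
    have "A \<inter> Pair n ` B = {}" using A(3) by blast
    then have cC: "card ?C = d"
      using A(1,2) finB cB by (simp add: card_Un_disjoint card_image inj_on_def)
    have "i < Suc n \<and> a < card {y \<in> ?C. fst y \<le> i}" if "(i, a) \<in> ?C" for i a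
      using that
    proof
      assume x: "(i, a) \<in> A"
      have "i < n" using A(3)[OF x] .
      then have "{y \<in> ?C. fst y \<le> i} = {y \<in> A. fst y \<le> i}" by auto
      then show ?thesis using A(4)[OF x] \<open>i < n\<close> by simp
    next
      assume x: "(i, a) \<in> Pair n ` B"
      then have "{y \<in> ?C. fst y \<le> i} = ?C" by (auto dest: A(3))
      then show ?thesis using x B cC by auto
    qed
    then show "?C \<in> wronsk_sets (Suc n) d"
      using A(1) finB cC by (simp add: wronsk_sets_def split_paired_all)
  qed
  show "(\<lambda>A. ({a. (n, a) \<in> A}, {y \<in> A. fst y < n})) \<in>
      wronsk_sets (Suc n) d \<rightarrow> (SIGMA B:Pow {..<d}. wronsk_sets n (d - card B))"
  proof
    fix A assume "A \<in> wronsk_sets (Suc n) d"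
    note A = wronsk_setsD[OF this]
    let ?B = "{a. (n, a) \<in> A}" and ?A = "{y \<in> A. fst y < n}"
    have le: "i \<le> n" if "(i, a) \<in> A" for i a using A(3)[OF that] by simp
    have lt: "i < n" if "(i, a) \<in> A" "i \<noteq> n" for i a using le[OF that(1)] that(2) by simp
    from le have all: "{y \<in> A. fst y \<le> n} = A" by auto
    have B: "?B \<subseteq> {..<d}" using A(2) A(4)[of n] all by auto
    have "A = ?A \<union> Pair n ` ?B"
    proof (intro equalityI subsetI)
      fix x assume x: "x \<in> A"
      show "x \<in> ?A \<union> Pair n ` ?B"
        using x lt[of "fst x" "snd x"] by (cases "fst x = n") (cases x; simp)+
    qed auto
    then have "card A = card (?A \<union> Pair n ` ?B)" by (rule arg_cong)
    also have "\<dots> = card ?A + card (Pair n ` ?B)"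
      by (rule card_Un_disjoint) (use A(1) finite_subset[OF B] in auto)
    also have "card (Pair n ` ?B) = card ?B" by (rule card_image) (simp add: inj_on_def)
    finally have "card ?A = d - card ?B" using A(2) by simp
    moreover have "a < card {y \<in> ?A. fst y \<le> i}" if "(i, a) \<in> ?A" for i a
    proof -
      have "{y \<in> ?A. fst y \<le> i} = {y \<in> A. fst y \<le> i}" using that by auto
      then show ?thesis using A(4)[of i a] that by simp
    qed
    ultimately have "?A \<in> wronsk_sets n (d - card ?B)"
      using A(1) by (simp add: wronsk_sets_def split_paired_all)
    then show "(?B, ?A) \<in> (SIGMA B:Pow {..<d}. wronsk_sets n (d - card B))"
      using B by simp
  qed
  show "({a. (n, a) \<in> (case x of (B, A) \<Rightarrow> A \<union> Pair n ` B)},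
      {y \<in> (case x of (B, A) \<Rightarrow> A \<union> Pair n ` B). fst y < n}) = x"
    if x: "x \<in> (SIGMA B:Pow {..<d}. wronsk_sets n (d - card B))" for x
  proof -
    obtain B A where BA: "x = (B, A)" by (cases x)
    then have "A \<in> wronsk_sets n (d - card B)" using x by simp
    then have lt: "i < n" if "(i, a) \<in> A" for i a using that by (rule wronsk_setsD)
    then have "(n, a) \<notin> A" for a by blast
    then show ?thesis unfolding BA by (auto dest: lt)
  qed
  show "(case ({a. (n, a) \<in> A}, {y \<in> A. fst y < n}) of (B, A) \<Rightarrow> A \<union> Pair n ` B) = A"
    if "A \<in> wronsk_sets (Suc n) d" for A
  proof -
    have "i \<le> n" if "(i, a) \<in> A" for i a
      using wronsk_setsD(3)[OF \<open>A \<in> wronsk_sets (Suc n) d\<close> that] by simp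
    then have lt: "i < n" if "(i, a) \<in> A" "i \<noteq> n" for i a
      using that le_neq_implies_less by blast
    show ?thesis
    proof (simp, intro equalityI subsetI)
      fix x assume x: "x \<in> A"
      show "x \<in> {y \<in> A. fst y < n} \<union> Pair n ` {a. (n, a) \<in> A}"
        using x lt[of "fst x" "snd x"] by (cases "fst x = n") (cases x; simp)+
    qed auto
  qed
qed

lemma wronsk_sets_subset: "A \<in> wronsk_sets n d \<Longrightarrow> A \<subseteq> {..<n} \<times> {..<d}"
proof
  fix x assume A: "A \<in> wronsk_sets n d" and x: "x \<in> A"
  have "card {y \<in> A. fst y \<le> fst x} \<le> card A"
    using A by (intro card_mono) (auto simp: wronsk_sets_def)
  then show "x \<in> {..<n} \<times> {..<d}"
    using wronsk_setsD(3,4)[OF A, of "fst x" "snd x"] wronsk_setsD(2)[OF A] x by (simp add: mem_Times_iff)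
qed

lemma finite_wronsk_sets: "finite (wronsk_sets n d)"
  by (rule finite_subset[of _ "Pow ({..<n} \<times> {..<d})"]) (use wronsk_sets_subset in auto)

lemma card_wronsk_sets: "card (wronsk_sets n d) = n ^ d"
proof (induction n arbitrary: d)
  case 0
  have "wronsk_sets 0 d \<subseteq> {{}}" by (auto simp: wronsk_sets_def)
  moreover have "{} \<in> wronsk_sets 0 d \<longleftrightarrow> d = 0" by (auto simp: wronsk_sets_def)
  ultimately have "wronsk_sets 0 d = (if d = 0 then {{}} else {})" by auto
  then show ?case by auto
next
  case (Suc n)
  have "card (wronsk_sets (Suc n) d) = (\<Sum>B\<in>Pow {..<d}. n ^ (d - card B))"
    by (simp add: finite_wronsk_sets Suc.IH flip: bij_betw_same_card[OF wronsk_sets_Suc])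
  \<comment> \<open>These are the summands in the expansion of (1 + n)^d over subsets.\<close>
  also have "\<dots> = (\<Sum>B\<in>Pow {..<d}. (\<Prod>c\<in>B. 1) * (\<Prod>c\<in>{..<d} - B. n))"
    by (intro sum.cong refl) (auto simp: card_Diff_subset finite_subset)
  also have "\<dots> = (\<Prod>c<d. 1 + n)"
    by (rule prod_add[symmetric]) simp
  finally show ?case by simp
qed

section \<open>Data as lists and as sets of pairs\<close>

definition data_pairs :: "nat list \<times> nat list list \<Rightarrow> (nat \<times> nat) list" where
  "data_pairs = (\<lambda>(m, \<alpha>). concat (map (\<lambda>i. map (Pair i) (\<alpha> ! i)) [0..<length m]))"

lemma W_eq_wronsk: "W D = wronsk (map (\<lambda>(i, a). (monom 1 a, i)) (data_pairs D))"
  by (simp add: W_def data_pairs_def map_concat o_def case_prod_unfold)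

lemma in_set_data_pairs:
  "(i, a) \<in> set (data_pairs (m, \<alpha>)) \<longleftrightarrow> i < length m \<and> a \<in> set (\<alpha> ! i)"
  by (auto simp: data_pairs_def)

lemma data_pairs_wronsk_sets:
  assumes "D \<in> wronsk_data N d"
  shows "set (data_pairs D) \<in> wronsk_sets (Suc N) d" "distinct (data_pairs D)"
    "length (data_pairs D) = d"
proof -
  obtain m \<alpha> where D: "D = (m, \<alpha>)" by (cases D)
  have m: "length m = Suc N" "(\<Sum>i\<le>N. m ! i) = d"
    and \<alpha>: "\<And>i. i \<le> N \<Longrightarrow> length (\<alpha> ! i) = m ! i" "\<And>i. i \<le> N \<Longrightarrow> sorted_wrt (<) (\<alpha> ! i)"
      "\<And>i a. i \<le> N \<Longrightarrow> a \<in> set (\<alpha> ! i) \<Longrightarrow> a < (\<Sum>j\<le>i. m ! j)"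
    using assms by (auto simp: wronsk_data_def D)
  let ?A = "set (data_pairs D)"
  have fib: "{a. (i, a) \<in> ?A} = set (\<alpha> ! i)" if "i \<le> N" for i
    using that m by (auto simp: D in_set_data_pairs)
  have card_fib: "card {a. (i, a) \<in> ?A} = m ! i" if "i \<le> N" for i
    using fib[OF that] \<alpha>(1,2)[OF that] by (simp add: distinct_card strict_sorted_iff)
  have le: "card {y \<in> ?A. fst y \<le> i} = (\<Sum>j\<le>i. m ! j)" if "i \<le> N" for i
    using that by (simp add: card_fst_le card_fib)
  have "{y \<in> ?A. fst y \<le> N} = ?A" using m by (auto simp: D in_set_data_pairs)
  then have card: "card ?A = d" using le[of N] m by simp
  show "?A \<in> wronsk_sets (Suc N) d"
    unfolding wronsk_sets_def
  proof (intro CollectI conjI ballI)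
    fix x assume "x \<in> ?A"
    then have "fst x < length m \<and> snd x \<in> set (\<alpha> ! fst x)"
      by (simp add: D flip: in_set_data_pairs)
    then have x: "fst x \<le> N" "snd x \<in> set (\<alpha> ! fst x)"
      by (simp_all add: m(1) less_Suc_eq_le)
    then show "fst x < Suc N" "snd x < card {y \<in> ?A. fst y \<le> fst x}"
      using le[OF x(1)] \<alpha>(3)[OF x] by auto
  qed (use card in auto)
  have "length (data_pairs D) = (\<Sum>i\<leftarrow>[0..<Suc N]. length (\<alpha> ! i))"
    by (simp add: D data_pairs_def length_concat o_def m(1) del: upt_Suc)
  also have "\<dots> = (\<Sum>i\<le>N. length (\<alpha> ! i))"
    by (simp add: sum_list_distinct_conv_sum_set atLeastLessThanSuc_atLeastAtMost atLeast0AtMost del: upt_Suc)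
  also have "\<dots> = d" using \<alpha>(1) m by simp
  finally show len: "length (data_pairs D) = d" .
  show "distinct (data_pairs D)" using card len by (intro card_distinct) simp
qed

text \<open>Sorting the fibres recovers the increasing tuples, and their lengths recover
  \<open>m\<close>.\<close>

lemma bij_betw_wronsk_sets:
  "bij_betw (\<lambda>D. set (data_pairs D)) (wronsk_data N d) (wronsk_sets (Suc N) d)"
  unfolding bij_betw_def
proof (intro conjI inj_onI)
  fix D D' assume D: "D \<in> wronsk_data N d" and D': "D' \<in> wronsk_data N d"
    and eq: "set (data_pairs D) = set (data_pairs D')"
  obtain m \<alpha> m' \<alpha>' where DD: "D = (m, \<alpha>)" "D' = (m', \<alpha>')" by (cases D, cases D')
  have "\<alpha> ! i = \<alpha>' ! i" if "i \<le> N" for i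
  proof (rule strict_sorted_equal)
    show "set (\<alpha> ! i) = set (\<alpha>' ! i)"
    proof (intro Set.set_eqI)
      fix a
      have "(i, a) \<in> set (data_pairs D) \<longleftrightarrow> (i, a) \<in> set (data_pairs D')" using eq by simp
      then show "a \<in> set (\<alpha> ! i) \<longleftrightarrow> a \<in> set (\<alpha>' ! i)"
        using D D' that by (simp add: DD in_set_data_pairs wronsk_data_def)
    qed
  qed (use D D' that in \<open>auto simp: DD wronsk_data_def\<close>)
  then have "\<alpha> = \<alpha>'"
    using D D' by (intro nth_equalityI) (auto simp: DD wronsk_data_def)
  moreover have "m = m'"
  proof (rule nth_equalityI)
    show "length m = length m'" using D D' by (simp add: DD wronsk_data_def)
    show "m ! i = m' ! i" if "i < length m" for i
      using D D' that \<open>\<alpha> = \<alpha>'\<close> by (auto simp: DD wronsk_data_def less_Suc_eq_le)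
  qed
  ultimately show "D = D'" by (simp add: DD)
next
  show "(\<lambda>D. set (data_pairs D)) ` wronsk_data N d = wronsk_sets (Suc N) d"
  proof (intro equalityI subsetI)
    fix A assume A: "A \<in> wronsk_sets (Suc N) d"
    then have finA: "finite A" by (simp add: wronsk_sets_def)
    have fin: "finite {a. (i, a) \<in> A}" for i
      by (rule finite_subset[of _ "snd ` A"]) (use finA in force)+
    define \<alpha> where "\<alpha> = map (\<lambda>i. sorted_list_of_set {a. (i, a) \<in> A}) [0..<Suc N]"
    define m where "m = map length \<alpha>"
    have \<alpha>: "\<alpha> ! i = sorted_list_of_set {a. (i, a) \<in> A}" if "i \<le> N" for i
      using that unfolding \<alpha>_def by (simp add: less_Suc_eq_le del: upt_Suc)
    have m: "m ! i = card {a. (i, a) \<in> A}" if "i \<le> N" for i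
      using that \<alpha>[OF that] by (simp add: m_def \<alpha>_def less_Suc_eq_le del: upt_Suc)
    have len: "length \<alpha> = Suc N" "length m = Suc N" by (simp_all add: \<alpha>_def m_def)
    have le: "(\<Sum>j\<le>i. m ! j) = card {y \<in> A. fst y \<le> i}" if "i \<le> N" for i
      using that by (simp add: card_fst_le[OF finA] m)
    have leN: "i \<le> N" if "(i, a) \<in> A" for i a using wronsk_setsD(3)[OF A that] by simp
    then have "{y \<in> A. fst y \<le> N} = A" by auto
    then have tot: "(\<Sum>i\<le>N. m ! i) = d" using le[of N] A by (simp add: wronsk_sets_def)
    have "a < (\<Sum>j\<le>i. m ! j)" if "i \<le> N" "a \<in> set (\<alpha> ! i)" for i a
    proof -
      have "(i, a) \<in> A" using that fin by (simp add: \<alpha>)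
      then show ?thesis using wronsk_setsD(4)[OF A] le[OF that(1)] by simp
    qed
    then have "(m, \<alpha>) \<in> wronsk_data N d"
      using len tot \<alpha> m fin by (simp add: wronsk_data_def)
    moreover have "set (data_pairs (m, \<alpha>)) = A"
    proof (intro Set.set_eqI)
      fix x
      obtain i a :: nat where x: "x = (i, a)" by (cases x)
      show "x \<in> set (data_pairs (m, \<alpha>)) \<longleftrightarrow> x \<in> A"
        using fin leN[of i a] by (auto simp: x in_set_data_pairs len less_Suc_eq_le \<alpha>)
    qed
    ultimately show "A \<in> (\<lambda>D. set (data_pairs D)) ` wronsk_data N d" by force
  qed (use data_pairs_wronsk_sets in auto)
qed

lemma finite_wronsk_data: "finite (wronsk_data N d)"
  using bij_betw_finite[OF bij_betw_wronsk_sets] finite_wronsk_sets by blast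

lemma card_wronsk_data: "card (wronsk_data N d) = (N + 1) ^ d"
  using bij_betw_same_card[OF bij_betw_wronsk_sets] card_wronsk_sets by simp


section \<open>Leading monomials and linear independence\<close>

lemma dvar_det_cong:
  assumes "\<And>c. c < d \<Longrightarrow> i c = i' c" "\<And>c. c < d \<Longrightarrow> a c = a' c"
  shows "dvar_det d i a = dvar_det d i' a'"
  unfolding dvar_det_expand using assms
  by (intro sum.cong arg_cong2[where f = "(*)"] prod.cong refl) auto

text \<open>Reordering columns costs only a sign, so any enumeration of the pairs may be used:
  increasing codes for independence, the columns of a given determinant for spanning.\<close>

lemma W_eq_scale_dvar_det:
  assumes D: "D \<in> wronsk_data N d" and e: "inj_on e {..<d}" "e ` {..<d} = set (data_pairs D)"
  obtains k where "k \<noteq> 0" "W D = scale k (dvar_det d (\<lambda>c. fst (e c)) (\<lambda>c. snd (e c)))"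
proof -
  let ?L = "data_pairs D" and ?E = "map e [0..<d]"
  note L = data_pairs_wronsk_sets[OF D]
  have "distinct ?E" using e(1) by (simp add: distinct_map atLeast0LessThan)
  moreover have "set ?E = set ?L" using e(2) by (simp add: atLeast0LessThan)
  ultimately have "mset ?L = mset ?E"
    using set_eq_iff_mset_eq_distinct[OF L(2), of ?E] by blast
  then obtain q where q: "q permutes {..<length ?E}" "permute_list q ?E = ?L"
    by (rule mset_eq_permutation)
  then have qd: "q permutes {..<d}" by simp
  have "?L ! c = e (q c)" if c: "c < d" for c
  proof -
    have "q c < d" using permutes_in_image[OF qd, of c] c by simp
    then show ?thesis using permute_list_nth[OF q(1), of c] c q(2) by simp
  qed
  then have "dvar_det d (\<lambda>c. fst (?L ! c)) (\<lambda>c. snd (?L ! c)) =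
      dvar_det d (\<lambda>c. fst (e (q c))) (\<lambda>c. snd (e (q c)))"
    by (intro dvar_det_cong) auto
  also have "\<dots> = of_int (sign q) * dvar_det d (\<lambda>c. fst (e c)) (\<lambda>c. snd (e c))"
    by (rule dvar_det_comp[OF qd])
  finally have "W D = scale ((\<Prod>r<d. fact r) * of_int (sign q)) (dvar_det d (\<lambda>c. fst (e c)) (\<lambda>c. snd (e c)))"
    by (simp add: W_eq_wronsk wronsk_monom[OF L(3)] scale_def const_mult const_of_int mult.assoc)
  moreover have "(\<Prod>r<d. fact r) * of_int (sign q) \<noteq> (0 :: complex)"
    by (simp add: sign_def)
  ultimately show ?thesis using that by blast
qed

lemma strictly_increasing_gap:
  fixes \<beta> :: "nat \<Rightarrow> nat"
  assumes "\<And>c c'. c < c' \<Longrightarrow> c' < d \<Longrightarrow> \<beta> c < \<beta> c'" "c \<le> c'" "c' < d"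
  shows "\<beta> c + (c' - c) \<le> \<beta> c'"
  using assms(2,3)
proof (induction c' rule: dec_induct)
  case (step n)
  then show ?case using assms(1)[of n "Suc n"] by simp
qed simp

text \<open>\<open>\<beta>\<close> enumerates the codes d i + a in increasing order; they can be
  decoded because a < d. The bound \<open>\<beta> c mod d \<le> c\<close> says that the diagonal of
  the determinant has no zero entry.\<close>

lemma wronsk_sets_enum:
  assumes A: "A \<in> wronsk_sets n d" and d: "1 \<le> d"
  shows "\<exists>\<beta>. (\<forall>c c'. c < c' \<longrightarrow> c' < d \<longrightarrow> \<beta> c < \<beta> c') \<and> (\<forall>c<d. \<beta> c mod d \<le> c) \<and>
    (\<lambda>c. (\<beta> c div d, \<beta> c mod d)) ` {..<d} = A \<and>
    inj_on (\<lambda>c. (\<beta> c div d, \<beta> c mod d)) {..<d}"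
proof -
  define code where "code x = d * fst x + snd x" for x
  define dec where "dec b = (b div d, b mod d)" for b
  have dec_code: "dec (code x) = x" if "x \<in> A" for x
  proof -
    have "snd x < d" using wronsk_sets_subset[OF A] that by auto
    then show ?thesis by (simp add: dec_def code_def prod_eq_iff)
  qed
  have code_dec: "code (dec b) = b" for b by (simp add: code_def dec_def)
  have inj_code: "inj_on code A" using dec_code by (rule inj_on_inverseI)
  define L where "L = sorted_list_of_set (code ` A)"
  define \<beta> where "\<beta> c = L ! c" for c
  have fin: "finite (code ` A)" using wronsk_setsD(1)[OF A] by simp
  have len: "length L = d"
    using card_image[OF inj_code] wronsk_setsD(2)[OF A] by (simp add: L_def)
  have mono: "\<beta> c < \<beta> c'" if "c < c'" "c' < d" for c c'
    unfolding \<beta>_def using that len by (intro sorted_wrt_nth_less[of "(<)"]) (auto simp: L_def)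
  have \<beta>_image: "\<beta> ` {..<d} = code ` A"
  proof -
    have "\<beta> ` {..<d} = set L"
      unfolding \<beta>_def len[symmetric] by (auto simp: set_conv_nth)
    then show ?thesis using fin by (simp add: L_def)
  qed
  have image: "(\<lambda>c. dec (\<beta> c)) ` {..<d} = A"
    unfolding image_image[of dec \<beta>, symmetric] \<beta>_image by (simp add: image_image dec_code)
  have inj: "inj_on (\<lambda>c. dec (\<beta> c)) {..<d}"
    by (rule eq_card_imp_inj_on) (simp_all add: image wronsk_setsD(2)[OF A])
  have le: "\<beta> c mod d \<le> c" if c: "c < d" for c
  proof -
    \<comment> \<open>\<open>e\<close> is the last position with the same index as \<open>c\<close>.
      At most \<open>e + 1\<close> pairs have at most this index, so the exponent at
      \<open>e\<close> is at most \<open>e\<close>; going back to \<open>c\<close> the exponent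
      drops by at least \<open>e - c\<close>.\<close>
    define S where "S = {c'. c' < d \<and> \<beta> c' div d \<le> \<beta> c div d}"
    define e where "e = Max S"
    have S: "finite S" "c \<in> S" using c by (auto simp: S_def)
    then have e: "e \<in> S" "c \<le> e" unfolding e_def using Max_in by auto
    then have ed: "e < d" by (simp add: S_def)
    have "{y \<in> A. fst y \<le> \<beta> e div d} \<subseteq> (\<lambda>c. dec (\<beta> c)) ` S"
      unfolding image[symmetric] using e(1) by (auto simp: S_def dec_def)
    then have "card {y \<in> A. fst y \<le> \<beta> e div d} \<le> card S"
      using surj_card_le[OF S(1)] by blast
    also have "\<dots> \<le> card {..e}"
      unfolding e_def using S by (intro card_mono) auto
    finally have 1: "card {y \<in> A. fst y \<le> \<beta> e div d} \<le> Suc e" by simp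
    have "dec (\<beta> e) \<in> A" using ed image by blast
    then have 2: "\<beta> e mod d < card {y \<in> A. fst y \<le> \<beta> e div d}"
      using wronsk_setsD(4)[OF A] unfolding dec_def by blast
    have gap: "\<beta> c + (e - c) \<le> \<beta> e"
      by (rule strictly_increasing_gap[OF mono e(2) ed])
    then have "\<beta> c div d \<le> \<beta> e div d" by (intro div_le_mono) simp
    then have eq: "\<beta> e div d = \<beta> c div d" using e(1) by (simp add: S_def)
    have "\<beta> e mod d = \<beta> e - d * (\<beta> c div d)" "\<beta> c mod d = \<beta> c - d * (\<beta> c div d)"
      using minus_mult_div_eq_mod[of "\<beta> e" d] eq minus_mult_div_eq_mod[of "\<beta> c" d] by simp_all
    moreover have "d * (\<beta> c div d) \<le> \<beta> c" by simp
    ultimately show ?thesis using 1 2 gap e(2) by linarith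
  qed
  show ?thesis
    by (rule exI[of _ \<beta>]) (use mono inj image le in \<open>simp add: dec_def\<close>)
qed

text \<open>The strict rearrangement inequality. If \<open>p\<close> does not fix the last position,
  exchanging values so that it does strictly increases the sum, and the induction hypothesis bounds
  the result.\<close>

lemma sum_mult_permutes_less:
  fixes \<beta> :: "nat \<Rightarrow> nat"
  assumes "\<And>c c'. c < c' \<Longrightarrow> c' < d \<Longrightarrow> \<beta> c < \<beta> c'" "p permutes {..<d}"
  shows "p = id \<or> (\<Sum>c<d. int (\<beta> c) * int (p c)) < (\<Sum>c<d. int (\<beta> c) * int c)"
  using assms
proof (induction d arbitrary: p)
  case 0
  then show ?case by simp
next
  case (Suc d)
  have IH: "q = id \<or> (\<Sum>c<d. int (\<beta> c) * int (q c)) < (\<Sum>c<d. int (\<beta> c) * int c)"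
    if "q permutes {..<d}" for q
    by (rule Suc.IH[OF _ that]) (use Suc.prems(1) in simp)
  have restrict: "q permutes {..<d}" if "q permutes {..<Suc d}" "q d = d" for q
    using that by (intro permutes_superset[OF that(1)]) (auto simp: less_Suc_eq)
  show ?case
  proof (cases "p d = d")
    case True
    then show ?thesis using IH[OF restrict[OF Suc.prems(2) True]] by auto
  next
    case False
    define e where "e = inv_into UNIV p d"
    have pe: "p e = d" unfolding e_def by (rule permutes_inverses(1)[OF Suc.prems(2)])
    have "e \<in> {..<Suc d}" using permutes_in_image[OF Suc.prems(2), of e] pe by simp
    moreover have "e \<noteq> d" using pe False by auto
    ultimately have e: "e < d" by simp
    have "p d \<in> {..<Suc d}" using permutes_in_image[OF Suc.prems(2), of d] by simp
    then have pd: "p d < d" using False by simp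
    define q where "q = p \<circ> transpose d e"
    have q: "q permutes {..<Suc d}" unfolding q_def
      by (rule permutes_compose[OF permutes_swap_id Suc.prems(2)]) (use e in auto)
    have qd: "q d = d" "q e = p d" "\<And>c. c \<noteq> d \<Longrightarrow> c \<noteq> e \<Longrightarrow> q c = p c"
      using pe by (auto simp: q_def transpose_def)
    have split: "(\<Sum>c<Suc d. f c) = (\<Sum>c\<in>{..<d} - {e}. f c) + f e + f d" for f :: "nat \<Rightarrow> int"
      using e by (simp add: sum.remove[of "{..<d}" e])
    have "(\<Sum>c<Suc d. int (\<beta> c) * int (q c)) - (\<Sum>c<Suc d. int (\<beta> c) * int (p c)) =
        (int (\<beta> d) - int (\<beta> e)) * (int d - int (p d))"
    proof -
      have "(\<Sum>c\<in>{..<d} - {e}. int (\<beta> c) * int (q c)) = (\<Sum>c\<in>{..<d} - {e}. int (\<beta> c) * int (p c))"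
        by (intro sum.cong) (auto simp: qd)
      then show ?thesis unfolding split by (simp add: qd pe algebra_simps)
    qed
    moreover have "0 < (int (\<beta> d) - int (\<beta> e)) * (int d - int (p d))"
      using Suc.prems(1)[of e d] e pd by (intro mult_pos_pos) auto
    moreover have "(\<Sum>c<Suc d. int (\<beta> c) * int (q c)) \<le> (\<Sum>c<Suc d. int (\<beta> c) * int c)"
      using IH[OF restrict[OF q qd(1)]] qd(1) by auto
    ultimately show ?thesis by linarith
  qed
qed

lemma const_mult_prod_dvar:
  "const k * (\<Prod>c<d. dvar (i c) (r c)) =
    Poly_Mapping.single (monom_of d i r) (k / (\<Prod>c<d. fact (r c)))"
  by (simp add: prod_dvar const_def mult_single)

lemma keys_dvar_detE:
  assumes "m \<in> Poly_Mapping.keys (dvar_det d i a)"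
  obtains p where "p permutes {..<d}" "\<And>c. c < d \<Longrightarrow> a c \<le> p c"
    "m = monom_of d i (\<lambda>c. p c - a c)"
proof -
  have "m \<in> (\<Union>p\<in>{p. p permutes {..<d}}. Poly_Mapping.keys (of_int (sign p) *
     (\<Prod>c<d. if a c \<le> p c then dvar (i c) (p c - a c) else 0)))"
    using assms keys_sum[of "\<lambda>p. of_int (sign p) *
     (\<Prod>c<d. if a c \<le> p c then dvar (i c) (p c - a c) else 0)"] unfolding dvar_det_expand by blast
  then obtain p where p: "p permutes {..<d}" and m: "m \<in> Poly_Mapping.keys (const (of_int (sign p)) *
     (\<Prod>c<d. if a c \<le> p c then dvar (i c) (p c - a c) else 0))"
    by (auto simp: const_of_int)
  have le: "a c \<le> p c" if "c < d" for c
  proof (rule ccontr)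
    assume "\<not> a c \<le> p c"
    then have "(\<Prod>c<d. if a c \<le> p c then dvar (i c) (p c - a c) else 0) = 0"
      using that by (intro prod_zero) auto
    then show False using m by simp
  qed
  then have eq: "(\<Prod>c<d. if a c \<le> p c then dvar (i c) (p c - a c) else 0) =
      (\<Prod>c<d. dvar (i c) (p c - a c))"
    by (intro prod.cong) auto
  have "m = monom_of d i (\<lambda>c. p c - a c)"
    using m unfolding eq const_mult_prod_dvar by (simp split: if_splits)
  then show ?thesis using that p le by blast
qed

text \<open>Only the cross term depends on \<open>p\<close>, so the least weight is the largest sum
  in the rearrangement inequality.\<close>

lemma sum_power2_permutes:
  fixes \<beta> :: "nat \<Rightarrow> nat"
  assumes p: "p permutes {..<d}"
  shows "(\<Sum>c<d. (int (p c) - int (\<beta> c))\<^sup>2) =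
    (\<Sum>c<d. (int c)\<^sup>2) + (\<Sum>c<d. (int (\<beta> c))\<^sup>2) - 2 * (\<Sum>c<d. int (\<beta> c) * int (p c))"
proof -
  have "(\<Sum>c<d. (int (p c))\<^sup>2) = (\<Sum>c<d. (int c)\<^sup>2)"
    using sum.reindex_bij_betw[OF permutes_imp_bij[OF p], of "\<lambda>c. (int c)\<^sup>2"] .
  moreover have "(\<Sum>c<d. (int (p c) - int (\<beta> c))\<^sup>2) =
      (\<Sum>c<d. (int (p c))\<^sup>2) + (\<Sum>c<d. (int (\<beta> c))\<^sup>2) - 2 * (\<Sum>c<d. int (\<beta> c) * int (p c))"
    by (simp add: power2_diff sum.distrib sum_subtractf sum_distrib_left algebra_simps)
  ultimately show ?thesis by simp
qed

text \<open>A variable of order s = c - \<gamma>_c mod d and index i = \<gamma>_c div d has s - d i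
  = c - \<gamma>_c, so a monomial determines the multiset of these differences. If it belongs to the
  permutation \<open>p\<close>, then either \<open>p\<close> is the identity and the differences
  agree up to order, or its weight exceeds that of the diagonal.\<close>

lemma dvar_det_leading:
  assumes mono: "\<And>c c'. c < c' \<Longrightarrow> c' < d \<Longrightarrow> \<beta> c < \<beta> c'"
    and m: "monom_of d (\<lambda>c. \<gamma> c div d) (\<lambda>c. c - \<gamma> c mod d) \<in>
      Poly_Mapping.keys (dvar_det d (\<lambda>c. \<beta> c div d) (\<lambda>c. \<beta> c mod d))"
    and \<gamma>: "\<And>c. c < d \<Longrightarrow> \<gamma> c mod d \<le> c"
  shows "(\<Sum>c<d. (int c - int (\<beta> c))\<^sup>2) < (\<Sum>c<d. (int c - int (\<gamma> c))\<^sup>2) \<or>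
    (\<exists>q. q permutes {..<d} \<and> (\<forall>c<d. int c - int (\<gamma> c) = int (q c) - int (\<beta> (q c))))"
proof -
  obtain p where p: "p permutes {..<d}" "\<And>c. c < d \<Longrightarrow> \<beta> c mod d \<le> p c"
    and eq: "monom_of d (\<lambda>c. \<gamma> c div d) (\<lambda>c. c - \<gamma> c mod d) =
      monom_of d (\<lambda>c. \<beta> c div d) (\<lambda>c. p c - \<beta> c mod d)"
    using keys_dvar_detE[OF m] by blast
  obtain q where q: "q permutes {..<d}" "\<And>c. c < d \<Longrightarrow> \<gamma> c div d = \<beta> (q c) div d"
    "\<And>c. c < d \<Longrightarrow> c - \<gamma> c mod d = p (q c) - \<beta> (q c) mod d"
    using monom_of_eqE[OF eq[symmetric]] by blast
  have key: "int c - int (\<gamma> c) = int (p (q c)) - int (\<beta> (q c))" if c: "c < d" for c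
  proof -
    have qc: "q c < d" using permutes_in_image[OF q(1), of c] c by simp
    have "int c - int (\<gamma> c mod d) = int (p (q c)) - int (\<beta> (q c) mod d)"
      using q(3)[OF c] \<gamma>[OF c] p(2)[OF qc] by linarith
    \<comment> \<open>Equal indices and equal orders are recombined into an equation between the
      codes.\<close>
    moreover have "int (\<gamma> c) = int d * int (\<gamma> c div d) + int (\<gamma> c mod d)"
      "int (\<beta> (q c)) = int d * int (\<beta> (q c) div d) + int (\<beta> (q c) mod d)"
      by (metis mult_div_mod_eq of_nat_add of_nat_mult)+
    ultimately show ?thesis using q(2)[OF c] by simp
  qed
  have "(\<Sum>c<d. (int c - int (\<gamma> c))\<^sup>2) = (\<Sum>c<d. (int (p (q c)) - int (\<beta> (q c)))\<^sup>2)"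
    by (intro sum.cong) (auto simp: key)
  also have "\<dots> = (\<Sum>c<d. (int (p c) - int (\<beta> c))\<^sup>2)"
    using sum.reindex_bij_betw[OF permutes_imp_bij[OF q(1)], of "\<lambda>c. (int (p c) - int (\<beta> c))\<^sup>2"] .
  finally have sq: "(\<Sum>c<d. (int c - int (\<gamma> c))\<^sup>2) = (\<Sum>c<d. (int (p c) - int (\<beta> c))\<^sup>2)" .
  have "p = id \<or> (\<Sum>c<d. int (\<beta> c) * int (p c)) < (\<Sum>c<d. int (\<beta> c) * int c)"
    by (rule sum_mult_permutes_less[OF mono p(1)])
  then show ?thesis
  proof
    assume "p = id"
    then show ?thesis using key q(1) by auto
  next
    assume "(\<Sum>c<d. int (\<beta> c) * int (p c)) < (\<Sum>c<d. int (\<beta> c) * int c)"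
    then show ?thesis
      using sum_power2_permutes[OF p(1), of \<beta>] sum_power2_permutes[OF permutes_id, where d = d and \<beta> = \<beta>] sq
      by simp
  qed
qed

text \<open>By the strict inequality no other permutation produces the diagonal monomial, so its
  coefficient, a product of inverse factorials, is not cancelled.\<close>

lemma leading_monom_in_keys:
  assumes mono: "\<And>c c'. c < c' \<Longrightarrow> c' < d \<Longrightarrow> \<beta> c < \<beta> c'"
    and le: "\<And>c. c < d \<Longrightarrow> \<beta> c mod d \<le> c"
  shows "monom_of d (\<lambda>c. \<beta> c div d) (\<lambda>c. c - \<beta> c mod d) \<in>
    Poly_Mapping.keys (dvar_det d (\<lambda>c. \<beta> c div d) (\<lambda>c. \<beta> c mod d))"
proof -
  let ?i = "\<lambda>c. \<beta> c div d" and ?a = "\<lambda>c. \<beta> c mod d"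
  let ?m = "monom_of d ?i (\<lambda>c. c - ?a c)"
  let ?t = "\<lambda>p. of_int (sign p) * (\<Prod>c<d. if ?a c \<le> p c then dvar (?i c) (p c - ?a c) else 0)"
  have other: "Poly_Mapping.lookup (?t p) ?m = 0" if p: "p permutes {..<d}" "p \<noteq> id" for p
  proof (cases "\<forall>c<d. ?a c \<le> p c")
    case False
    then have "(\<Prod>c<d. if ?a c \<le> p c then dvar (?i c) (p c - ?a c) else 0) = 0"
      by (intro prod_zero) auto
    then show ?thesis by simp
  next
    case True
    have "?m \<noteq> monom_of d ?i (\<lambda>c. p c - ?a c)"
    proof
      assume "?m = monom_of d ?i (\<lambda>c. p c - ?a c)"
      then obtain q where q: "q permutes {..<d}" "\<And>c. c < d \<Longrightarrow> \<beta> c div d = \<beta> (q c) div d"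
        "\<And>c. c < d \<Longrightarrow> p c - ?a c = q c - ?a (q c)"
        using monom_of_eqE by blast
      have key: "int (p c) - int (\<beta> c) = int (q c) - int (\<beta> (q c))" if c: "c < d" for c
      proof -
        have qc: "q c < d" using permutes_in_image[OF q(1), of c] c by simp
        have "int (p c) - int (?a c) = int (q c) - int (?a (q c))"
          using q(3)[OF c] True[rule_format, OF c] le[OF qc] by linarith
        moreover have "int (\<beta> c) = int d * int (\<beta> c div d) + int (?a c)"
          "int (\<beta> (q c)) = int d * int (\<beta> (q c) div d) + int (?a (q c))"
          by (metis mult_div_mod_eq of_nat_add of_nat_mult)+
        ultimately show ?thesis using q(2)[OF c] by simp
      qed
      have "(\<Sum>c<d. (int (p c) - int (\<beta> c))\<^sup>2) = (\<Sum>c<d. (int (q c) - int (\<beta> (q c)))\<^sup>2)"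
        by (intro sum.cong) (auto simp: key)
      also have "\<dots> = (\<Sum>c<d. (int c - int (\<beta> c))\<^sup>2)"
        using sum.reindex_bij_betw[OF permutes_imp_bij[OF q(1)], of "\<lambda>c. (int c - int (\<beta> c))\<^sup>2"] .
      finally have "(\<Sum>c<d. int (\<beta> c) * int (p c)) = (\<Sum>c<d. int (\<beta> c) * int c)"
        using sum_power2_permutes[OF p(1), of \<beta>] sum_power2_permutes[OF permutes_id, where d = d and \<beta> = \<beta>] by simp
      moreover have "p = id \<or> (\<Sum>c<d. int (\<beta> c) * int (p c)) < (\<Sum>c<d. int (\<beta> c) * int c)"
        by (rule sum_mult_permutes_less[OF mono p(1)])
      ultimately show False using p(2) by simp
    qed
    moreover have "(\<Prod>c<d. if ?a c \<le> p c then dvar (?i c) (p c - ?a c) else 0) =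
        (\<Prod>c<d. dvar (?i c) (p c - ?a c))"
      using True by (intro prod.cong) auto
    then have "?t p = const (of_int (sign p)) * (\<Prod>c<d. dvar (?i c) (p c - ?a c))"
      by (simp only: const_of_int)
    ultimately show ?thesis
      by (simp add: lookup_const_mult prod_dvar lookup_single when_def)
  qed
  have "(\<Prod>c<d. if ?a c \<le> id c then dvar (?i c) (id c - ?a c) else 0) =
      (\<Prod>c<d. dvar (?i c) (c - ?a c))"
    using le by (intro prod.cong) auto
  then have id: "Poly_Mapping.lookup (?t id) ?m = 1 / (\<Prod>c<d. fact (c - ?a c))"
    by (simp add: sign_id prod_dvar)
  have "Poly_Mapping.lookup (dvar_det d ?i ?a) ?m =
      (\<Sum>p | p permutes {..<d}. Poly_Mapping.lookup (?t p) ?m)"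
    by (simp add: dvar_det_expand lookup_sum)
  also have "\<dots> = (\<Sum>p | p permutes {..<d}. if p = id then Poly_Mapping.lookup (?t id) ?m else 0)"
    by (intro sum.cong refl) (use other in auto)
  also have "\<dots> = Poly_Mapping.lookup (?t id) ?m"
    by (simp add: finite_permutations permutes_id)
  finally show ?thesis unfolding id by (simp add: in_keys_iff)
qed

text \<open>Since \<open>\<beta>\<^sub>c - c\<close> is nondecreasing in \<open>c\<close>, this recovers \<open>\<beta>\<close> from the multiset of its values,
  hence from the diagonal monomial.\<close>

lemma mono_permutes_eq:
  fixes f g :: "nat \<Rightarrow> int"
  assumes q: "q permutes {..<d}" and eq: "\<And>c. c < d \<Longrightarrow> f c = g (q c)"
    and f: "\<And>c c'. c \<le> c' \<Longrightarrow> c' < d \<Longrightarrow> f c \<le> f c'"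
    and g: "\<And>c c'. c \<le> c' \<Longrightarrow> c' < d \<Longrightarrow> g c \<le> g c'"
    and c: "c < d"
  shows "f c = g c"
proof -
  have "map f [0..<d] = permute_list q (map g [0..<d])"
  proof (rule nth_equalityI)
    fix k assume "k < length (map f [0..<d])"
    then have k: "k < d" by simp
    then have "q k < d" using permutes_in_image[OF q, of k] by simp
    then show "map f [0..<d] ! k = permute_list q (map g [0..<d]) ! k"
      using q k by (simp add: permute_list_nth eq)
  qed simp
  then have "mset (map f [0..<d]) = mset (map g [0..<d])"
    using mset_permute_list[of q "map g [0..<d]"] q by simp
  moreover have "sorted (map f [0..<d])" "sorted (map g [0..<d])"
    using f g by (auto simp: sorted_iff_nth_mono)
  ultimately have "map f [0..<d] = map g [0..<d]"
    by (metis properties_for_sort)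
  then show ?thesis using c by simp
qed

text \<open>In a vanishing combination take \<open>x\<close> of least \<open>w\<close> among the
  members with nonzero coefficient: no other such member contains the monomial
  \<open>\<mu> x\<close>, so it cannot cancel.\<close>

lemma independent_by_leading_keys:
  fixes F :: "'a \<Rightarrow> dpoly" and w :: "'a \<Rightarrow> int"
  assumes fin: "finite A"
    and key: "\<And>x. x \<in> A \<Longrightarrow> \<mu> x \<in> Poly_Mapping.keys (F x)"
    and tri: "\<And>x y. x \<in> A \<Longrightarrow> y \<in> A \<Longrightarrow> \<mu> x \<in> Poly_Mapping.keys (F y) \<Longrightarrow> x = y \<or> w y < w x"
  shows "inj_on F A" "dp.independent (F ` A)"
proof -
  show inj: "inj_on F A"
  proof (rule inj_onI)
    fix x y assume "x \<in> A" "y \<in> A" "F x = F y"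
    then show "x = y" using key[of x] key[of y] tri[of x y] tri[of y x] by force
  qed
  show "dp.independent (F ` A)"
  proof (rule ccontr)
    assume "\<not> dp.independent (F ` A)"
    then have "\<exists>u. (\<exists>v\<in>F ` A. u v \<noteq> 0) \<and> (\<Sum>v\<in>F ` A. scale (u v) v) = 0"
      using dp.dependent_finite[of "F ` A"] fin by blast
    then obtain u v where v: "v \<in> F ` A" "u v \<noteq> 0"
      and 0: "(\<Sum>v\<in>F ` A. scale (u v) v) = 0" by blast
    define B where "B = {x \<in> A. u (F x) \<noteq> 0}"
    have "finite B" "B \<noteq> {}" using fin v by (auto simp: B_def)
    then obtain x where x: "x \<in> B" and min: "\<And>y. y \<in> B \<Longrightarrow> w x \<le> w y"
      using ex_min_if_finite[of "w ` B"] by (force simp: not_less)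
    have "0 = Poly_Mapping.lookup (\<Sum>y\<in>A. scale (u (F y)) (F y)) (\<mu> x)"
      using 0 by (simp add: sum.reindex[OF inj])
    also have "\<dots> = (\<Sum>y\<in>A. u (F y) * Poly_Mapping.lookup (F y) (\<mu> x))"
      by (simp add: lookup_sum scale_def lookup_const_mult)
    also have "\<dots> = (\<Sum>y\<in>A. if y = x then u (F x) * Poly_Mapping.lookup (F x) (\<mu> x) else 0)"
    proof (rule sum.cong[OF refl])
      fix y assume y: "y \<in> A"
      show "u (F y) * Poly_Mapping.lookup (F y) (\<mu> x) =
          (if y = x then u (F x) * Poly_Mapping.lookup (F x) (\<mu> x) else 0)"
      proof (cases "y = x \<or> u (F y) = 0")
        case False
        then have "\<mu> x \<notin> Poly_Mapping.keys (F y)"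
          using tri[of x y] min[of y] x y by (auto simp: B_def)
        then show ?thesis using False by (simp add: in_keys_iff)
      qed (use x in \<open>auto simp: B_def\<close>)
    qed
    also have "\<dots> = u (F x) * Poly_Mapping.lookup (F x) (\<mu> x)"
      using fin x by (simp add: B_def)
    finally show False using x key[of x] by (simp add: B_def in_keys_iff)
  qed
qed

lemma keys_scale: "k \<noteq> 0 \<Longrightarrow> Poly_Mapping.keys (scale k P) = Poly_Mapping.keys P"
  by (auto simp: in_keys_iff scale_def lookup_const_mult)

lemma W_independent:
  assumes d: "1 \<le> d"
  shows "inj_on W (wronsk_data N d)" "dp.independent (W ` wronsk_data N d)"
proof -
  let ?dec = "\<lambda>b. (b div d, b mod d)"
  let ?P = "\<lambda>D \<beta>. (\<forall>c c'. c < c' \<longrightarrow> c' < d \<longrightarrow> \<beta> c < \<beta> c') \<and>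
    (\<forall>c<d. \<beta> c mod d \<le> c) \<and> (\<lambda>c. ?dec (\<beta> c)) ` {..<d} = set (data_pairs D) \<and>
    (\<exists>k. k \<noteq> 0 \<and> W D = scale k (dvar_det d (\<lambda>c. \<beta> c div d) (\<lambda>c. \<beta> c mod d)))"
  have "\<exists>\<beta>. ?P D \<beta>" if D: "D \<in> wronsk_data N d" for D
  proof -
    obtain \<beta> where \<beta>: "\<forall>c c'. c < c' \<longrightarrow> c' < d \<longrightarrow> \<beta> c < \<beta> c'" "\<forall>c<d. \<beta> c mod d \<le> c"
      "(\<lambda>c. ?dec (\<beta> c)) ` {..<d} = set (data_pairs D)" "inj_on (\<lambda>c. ?dec (\<beta> c)) {..<d}"
      using wronsk_sets_enum[OF data_pairs_wronsk_sets(1)[OF D] d] by (elim exE conjE)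
    obtain k where "k \<noteq> 0" "W D = scale k (dvar_det d (\<lambda>c. \<beta> c div d) (\<lambda>c. \<beta> c mod d))"
      using W_eq_scale_dvar_det[OF D \<beta>(4,3)] by auto
    then have "\<exists>k. k \<noteq> 0 \<and> W D = scale k (dvar_det d (\<lambda>c. \<beta> c div d) (\<lambda>c. \<beta> c mod d))"
      by (intro exI conjI)
    then show ?thesis using \<beta>(1-3) by (intro exI[of _ \<beta>] conjI)
  qed
  then have "\<forall>D\<in>wronsk_data N d. \<exists>\<beta>. ?P D \<beta>" by (rule ballI)
  from bchoice[OF this] obtain \<beta> where "\<forall>D\<in>wronsk_data N d. ?P D (\<beta> D)" by (rule exE)
  note \<beta> = this[rule_format]
  have mono: "\<beta> D c < \<beta> D c'" if "D \<in> wronsk_data N d" "c < c'" "c' < d" for D c c'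
    by (rule \<beta>[OF that(1), THEN conjunct1, rule_format, OF that(2,3)])
  have le: "\<beta> D c mod d \<le> c" if "D \<in> wronsk_data N d" "c < d" for D c
    by (rule \<beta>[OF that(1), THEN conjunct2, THEN conjunct1, rule_format, OF that(2)])
  have image: "(\<lambda>c. ?dec (\<beta> D c)) ` {..<d} = set (data_pairs D)" if "D \<in> wronsk_data N d" for D
    by (rule \<beta>[OF that, THEN conjunct2, THEN conjunct2, THEN conjunct1])
  define \<mu> where "\<mu> D = monom_of d (\<lambda>c. \<beta> D c div d) (\<lambda>c. c - \<beta> D c mod d)" for D
  \<comment> \<open>The weight of \<open>\<mu> D\<close>: each factor contributes (s - d i)^2, where
    s - d i = c - \<beta>_c.\<close>
  define w where "w D = (\<Sum>c<d. (int c - int (\<beta> D c))\<^sup>2)" for D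
  have keys: "Poly_Mapping.keys (W D) =
      Poly_Mapping.keys (dvar_det d (\<lambda>c. \<beta> D c div d) (\<lambda>c. \<beta> D c mod d))"
    if "D \<in> wronsk_data N d" for D
    using \<beta>[OF that, THEN conjunct2, THEN conjunct2, THEN conjunct2] by (elim exE conjE) (simp add: keys_scale)
  have key: "\<mu> D \<in> Poly_Mapping.keys (W D)" if "D \<in> wronsk_data N d" for D
    unfolding keys[OF that] \<mu>_def by (rule leading_monom_in_keys[OF mono[OF that] le[OF that]])
  have tri: "D = D' \<or> w D' < w D" if D: "D \<in> wronsk_data N d" "D' \<in> wronsk_data N d"
    and m: "\<mu> D \<in> Poly_Mapping.keys (W D')" for D D'
  proof -
    have "w D' < w D \<or>
      (\<exists>q. q permutes {..<d} \<and> (\<forall>c<d. int c - int (\<beta> D c) = int (q c) - int (\<beta> D' (q c))))"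
      unfolding w_def
      by (rule dvar_det_leading[OF mono[OF D(2)] m[unfolded keys[OF D(2)] \<mu>_def] le[OF D(1)]])
    moreover have "D = D'" if q: "q permutes {..<d}"
      and eq: "\<And>c. c < d \<Longrightarrow> int c - int (\<beta> D c) = int (q c) - int (\<beta> D' (q c))" for q
    proof -
      have inc: "int (\<beta> E c) - int c \<le> int (\<beta> E c') - int c'"
        if "E \<in> wronsk_data N d" "c \<le> c'" "c' < d" for E c c'
      proof -
        have "\<beta> E c + (c' - c) \<le> \<beta> E c'"
          by (rule strictly_increasing_gap[OF mono[OF that(1)] that(2,3)])
        then show ?thesis using that(2) by linarith
      qed
      have "int (\<beta> D c) - int c = int (\<beta> D' c) - int c" if "c < d" for c
      proof (rule mono_permutes_eq[OF q, where f = "\<lambda>c. int (\<beta> D c) - int c"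
              and g = "\<lambda>c. int (\<beta> D' c) - int c"])
        show "int (\<beta> D c) - int c = int (\<beta> D' (q c)) - int (q c)" if "c < d" for c
          using eq[OF that] by linarith
        show "int (\<beta> D c) - int c \<le> int (\<beta> D c') - int c'"
          "int (\<beta> D' c) - int c \<le> int (\<beta> D' c') - int c'" if "c \<le> c'" "c' < d" for c c'
          using inc[OF D(1) that] inc[OF D(2) that] .
      qed (rule that)
      \<comment> \<open>The codes determine the pairs, and the set of pairs determines the
        datum.\<close>
      then have "\<beta> D c = \<beta> D' c" if "c < d" for c using that by simp
      then have "(\<lambda>c. ?dec (\<beta> D c)) ` {..<d} = (\<lambda>c. ?dec (\<beta> D' c)) ` {..<d}"
        by (intro image_cong) auto
      then have "set (data_pairs D) = set (data_pairs D')" unfolding image[OF D(1)] image[OF D(2)] .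
      then show ?thesis
        using inj_onD[OF bij_betw_imp_inj_on[OF bij_betw_wronsk_sets]] D by blast
    qed
    ultimately show ?thesis by blast
  qed
  show "inj_on W (wronsk_data N d)"
    by (rule independent_by_leading_keys(1)[where \<mu> = \<mu> and w = w, OF finite_wronsk_data key tri])
  show "dp.independent (W ` wronsk_data N d)"
    by (rule independent_by_leading_keys(2)[where \<mu> = \<mu> and w = w, OF finite_wronsk_data key tri])
qed

section \<open>Spanning by Wronskians and the bound on the order\<close>

text \<open>Reduction with the indices \<open>i\<close> leads to exponents that obey the bounds of
  \<open>wronsk_sets\<close>. Then either two columns coincide and the determinant is 0, or the
  columns form a datum and it is a multiple of the corresponding \<open>W D\<close>.\<close>

lemma dvar_det_in_span_W:
  assumes i: "\<And>c. c < d \<Longrightarrow> i c \<le> N"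
  shows "dvar_det d i a \<in> dp.span (W ` wronsk_data N d)"
proof (rule coinvariant_reduce[OF coinvariant_dvar_det, where i = i])
  fix b assume good: "\<And>c. c < d \<Longrightarrow> b c < card {c'. c' < d \<and> i c' \<le> i c}"
  let ?e = "\<lambda>c. (i c, b c)"
  show "dvar_det d i b \<in> dp.span (W ` wronsk_data N d)"
  proof (cases "inj_on ?e {..<d}")
    case False
    then obtain u v where "u < d" "v < d" "u \<noteq> v" "i u = i v" "b u = b v"
      by (auto simp: inj_on_def)
    then have "dvar_det d i b = 0" by (rule dvar_det_eq_0)
    then show ?thesis by (simp add: dp.span_zero)
  next
    case True
    let ?A = "?e ` {..<d}"
    have card: "card {y \<in> ?A. fst y \<le> j} = card {c'. c' < d \<and> i c' \<le> j}" for j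
    proof -
      have "{y \<in> ?A. fst y \<le> j} = ?e ` {c'. c' < d \<and> i c' \<le> j}" by auto
      then show ?thesis using card_image[OF inj_on_subset[OF True], of "{c'. c' < d \<and> i c' \<le> j}"] by auto
    qed
    have "?A \<in> wronsk_sets (Suc N) d"
      using i good card_image[OF True] by (auto simp: wronsk_sets_def card less_Suc_eq_le)
    then have "?A \<in> (\<lambda>D. set (data_pairs D)) ` wronsk_data N d"
      using bij_betw_imp_surj_on[OF bij_betw_wronsk_sets[of N d]] by simp
    then obtain D where D: "D \<in> wronsk_data N d" "?A = set (data_pairs D)" by blast
    obtain k where k: "k \<noteq> 0" "W D = scale k (dvar_det d i b)"
      using W_eq_scale_dvar_det[OF D(1) True D(2)] by auto
    then have "dvar_det d i b = scale (1 / k) (W D)" by simp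
    then show ?thesis using D(1) by (simp add: dp.span_scale dp.span_base)
  qed
qed (auto simp: dp.span_zero dp.span_diff)

lemma subspace_diff_homogeneous: "dp.subspace {P. diff_homogeneous d P}"
  by (rule dp.subspaceI)
    (auto simp: diff_homogeneous_def act_0 act_add act_mult act_const scale_def algebra_simps
      smult_add_left)

lemma subspace_indets: "dp.subspace {P. indets P \<subseteq> B}"
proof (rule dp.subspaceI)
  show "P + Q \<in> {P. indets P \<subseteq> B}" if "P \<in> {P. indets P \<subseteq> B}" "Q \<in> {P. indets P \<subseteq> B}" for P Q
  proof -
    have "indets (P + Q) \<subseteq> indets P \<union> indets Q"
      using Poly_Mapping.keys_add[of P Q] unfolding indets_def by blast
    then show ?thesis using that by blast
  qed
  show "scale c P \<in> {P. indets P \<subseteq> B}" if "P \<in> {P. indets P \<subseteq> B}" for c P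
    using that by (cases "c = 0") (auto simp: indets_def keys_scale)
qed (simp add: indets_def)

lemma subspace_Vdiff: "dp.subspace (Vdiff N d)"
proof -
  have "Vdiff N d = {P. indets P \<subseteq> {..N} \<times> UNIV} \<inter> {P. diff_homogeneous d P}"
    by (auto simp: Vdiff_def diff_polys_def)
  then show ?thesis
    by (simp only: dp.subspace_inter[OF subspace_indets subspace_diff_homogeneous])
qed

lemma subspace_Vdiff_order: "dp.subspace (Vdiff_order N d k)"
proof -
  have "Vdiff_order N d k = Vdiff N d \<inter> {P. indets P \<subseteq> {..N} \<times> {..k}}"
    by (auto simp: Vdiff_order_def)
  then show ?thesis
    by (simp only: dp.subspace_inter[OF subspace_Vdiff subspace_indets])
qed

lemma indets_dvar_det:
  assumes "\<And>c. c < d \<Longrightarrow> i c \<le> N"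
  shows "indets (dvar_det d i a) \<subseteq> {..N} \<times> {..d - 1}"
proof
  fix v assume "v \<in> indets (dvar_det d i a)"
  then obtain m where m: "m \<in> Poly_Mapping.keys (dvar_det d i a)" "v \<in> Poly_Mapping.keys m"
    by (auto simp: indets_def)
  obtain p where p: "p permutes {..<d}" "m = monom_of d i (\<lambda>c. p c - a c)"
    using keys_dvar_detE[OF m(1)] by blast
  obtain c where c: "c < d" "v = (i c, p c - a c)"
    using m(2) unfolding p(2) by (auto simp: in_keys_iff lookup_monom_of count_eq_zero_iff)
  have "p c < d" using permutes_in_image[OF p(1), of c] c by simp
  then show "v \<in> {..N} \<times> {..d - 1}" using assms c by auto
qed

lemma W_in_Vdiff_order:
  assumes D: "D \<in> wronsk_data N d"
  shows "W D \<in> Vdiff_order N d (d - 1)"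
proof -
  let ?L = "data_pairs D"
  note L = data_pairs_wronsk_sets[OF D]
  let ?P = "dvar_det d (\<lambda>c. fst (?L ! c)) (\<lambda>c. snd (?L ! c))"
  have "fst (?L ! c) \<le> N" if "c < d" for c
    using wronsk_setsD(3)[OF L(1), of "fst (?L ! c)" "snd (?L ! c)"] nth_mem[of c ?L] that L(3)
    by simp
  then have ind: "indets ?P \<subseteq> {..N} \<times> {..d - 1}" by (rule indets_dvar_det)
  then have "indets ?P \<subseteq> {..N} \<times> UNIV" by blast
  with ind have "?P \<in> Vdiff_order N d (d - 1)"
    by (simp add: Vdiff_order_def Vdiff_def diff_polys_def diff_homogeneous_dvar_det)
  then show ?thesis
    by (simp add: W_eq_wronsk wronsk_monom[OF L(3)] dp.subspace_scale[OF subspace_Vdiff_order])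
qed

theorem theorem0p0p1:
  fixes N d :: nat
  assumes "N \<ge> 1" and "d \<ge> 1"
  shows "dp.dim (Vdiff N d) = (N + 1) ^ d \<and>
    (inj_on W (wronsk_data N d) \<and>
     dp.independent (W ` wronsk_data N d) \<and>
     dp.span (W ` wronsk_data N d) = Vdiff N d) \<and>
    Vdiff N d = Vdiff_order N d (d - 1)"
proof -
  let ?B = "W ` wronsk_data N d"
  have order: "Vdiff_order N d (d - 1) \<subseteq> Vdiff N d" by (auto simp: Vdiff_order_def)
  \<comment> \<open>The inclusions from the span to \<open>Vdiff_order\<close>, to
    \<open>Vdiff\<close> and back to the span close a circle, which yields spanning and the bound on
    the order together.\<close>
  have "dp.span ?B \<subseteq> Vdiff_order N d (d - 1)"
    by (rule dp.span_minimal[OF _ subspace_Vdiff_order]) (use W_in_Vdiff_order in auto)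
  moreover have "Vdiff N d \<subseteq> dp.span ?B"
  proof
    fix P assume "P \<in> Vdiff N d"
    then have "P \<in> dp.span {dvar_det d i a | i a. i \<in> PiE {..<d} (\<lambda>_. {..N})}"
      by (rule diff_homogeneous_in_span_dvar_det)
    also have "\<dots> \<subseteq> dp.span ?B"
      by (rule dp.span_minimal[OF _ dp.subspace_span]) (auto intro!: dvar_det_in_span_W)
    finally show "P \<in> dp.span ?B" .
  qed
  ultimately have span: "dp.span ?B = Vdiff N d" and eq: "Vdiff N d = Vdiff_order N d (d - 1)"
    using order by blast+
  note ind = W_independent[OF assms(2), of N]
  have "dp.dim (Vdiff N d) = card ?B"
    by (rule dp.dim_eq_card[OF _ ind(2)]) (simp only: span[symmetric] dp.span_span)
  then have "dp.dim (Vdiff N d) = (N + 1) ^ d"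
    by (simp add: card_image[OF ind(1)] card_wronsk_data)
  then show ?thesis using ind span eq by (intro conjI)
qed

end
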